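(* Let $Y,U,R,O$ be real Hilbert spaces (the case $R=\{0\}$ is allowed) and put $M=U\times R$. Let $T\colon Y\to O$, $K_U\colon Y\to U'$, $K_R\colon Y\to R'$ be bounded linear operators and put $Ky=(K_Uy,K_Ry)^\top\in M'$ for $y\in Y$. Assume: (K1) there is a constant $c_K>0$ such that $\|y\|_Y\le c_K\|Ky\|_{M'}=c_K\sqrt{\|K_Uy\|_{U'}^2+\|K_Ry\|_{R'}^2}$ for all $y\in Y$; (K2) $K_R\colon Y\to R'$ is surjective, or, equivalently, there is a constant $c_R>0$ such that $\sup_{0\ne y\in Y}\frac{\langle K_Ry,r\rangle}{\|y\|_Y}\ge c_R\|r\|_R$ for all $r\in R$. For $\alpha>0$ let $\bm X=U\times U\times Y\times R$ and let $\mathcal A\colon\bm X\to\bm X'$ and $\mathcal P\colon\bm X\to\bm X'$ be given by $$\mathcal A=\begin{pmatrix}\alpha\mathcal I_U&\mathcal I_U&0&0\\ \mathcal I_U&0&K_U&0\\ 0&K_U'&T'\mathcal I_OT&K_R'\\ 0&0&K_R&0\end{pmatrix},\qquad \mathcal P=\begin{pmatrix}\alpha\mathcal I_U&&&\\ &\alpha^{-1}\mathcal I_U&&\\ &&T'\mathcal I_OT+\alpha K_U'\mathcal I_U^{-1}K_U+K_R'\mathcal I_R^{-1}K_R&\\ &&&\mathcal I_R\end{pmatrix}.$$ Then for every $\alpha>0$ the operator $\mathcal A$ is a self-adjoint isomorphism. Furthermore, for the Hilbert space $\bm X$ endowed with the inner product $(\bm x,\bm y)_{\mathcal P}=\langle\mathcal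 P\bm x,\bm y\rangle$, with induced norm $\|\cdot\|_{\mathcal P}$, there exist positive constants $\underline c$ and $\overline c$, both independent of $\alpha\in(0,1]$, such that $$\underline c\,\|\bm x\|_{\mathcal P}\le\|\mathcal P^{-1}\mathcal A\bm x\|_{\mathcal P}\le\overline c\,\|\bm x\|_{\mathcal P}\quad\text{for all }\bm x\in\bm X.\qquad( * )$$ If, instead of (K2), the following stronger assumption holds: (K2') the restriction $K_R|_{\ker K_U}\colon\ker K_U\to R'$ is surjective, or, equivalently, there is a constant $c_R>0$ such that $\sup_{0\ne y\in\ker K_U}\frac{\langle K_Ry,r\rangle}{\|y\|_Y}\ge c_R\|r\|_R$ for all $r\in R$, then the constants $\underline c,\overline c$ in $( * )$ are independent of all $\alpha>0$.
   Context: For a real Hilbert space $X$, $X'$ denotes its dual (with the dual norm) and $\langle\cdot,\cdot\rangle$ the duality pairing; dual spaces of product spaces are identified with products of the dual spaces, and product spaces carry the canonical inner product. For a bounded linear operator $B\colon X\to Z'$ the adjoint $B'\colon Z\to X'$ is defined by $\langle B'z,x\rangle=\langle Bx,z\rangle$ for all $x\in X$, $z\in Z$. A bounded linear operator $A\colon X\to X'$ is self-adjoint if $\langle Ay,x\rangle=\langle Ax,y\rangle$ for all $x,y\in X$. For a Hilbert space $X$, $\mathcal I_X\colon X\to X'$ is the operator given by $\langle\mathcal I_Xx,y\rangle=(x,y)_X$ (its inverse is the Riesz isomorphism). The operator $T'\mathcal I_OT\colon Y\to Y'$ is $y\mapsto(Ty,T\,\cdot)_O$. The operator $\mathcal A$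 is the (reordered) optimality system operator, for unknowns $(u,p_U,y,p_R)$, of the problem of minimizing $\frac12\|Ty-d\|_O^2+\frac\alpha2\|u\|_U^2$ over $(y,u)\in Y\times U$ subject to $K_Uy+\mathcal I_Uu=g_U$, $K_Ry=g_R$. "Independent of $\alpha$" means that, for fixed spaces and operators $T,K_U,K_R$, the same constants work for all the indicated values of $\alpha$. *)

theory Defs
  imports "HOL-Analysis.Analysis"
begin

text \<open>
  Real Hilbert spaces are types of sort \<open>{real_inner, complete_space}\<close> (the zero space is allowed);
  product types carry the canonical inner product.
\<close>

type_synonym 'a dual = "'a \<Rightarrow>\<^sub>L real"

subsection \<open>The operator \<open>\<I>\<^sub>X\<close> and the Riesz isomorphism\<close>

lift_definition riesz :: "'a::real_inner \<Rightarrow>\<^sub>L 'a dual" is blinfun_inner_right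
  by (rule bounded_linear_blinfun_inner_right)

lemma riesz_apply [simp]: "riesz x y = x \<bullet> y"
  by transfer (simp add: blinfun_inner_right.rep_eq)

lemma norm_riesz_apply [simp]: "norm (riesz x) = norm x"
proof (rule antisym)
  show "norm (riesz x) \<le> norm x"
    by (rule norm_blinfun_bound) (simp_all add: Cauchy_Schwarz_ineq2)
  have "norm x * norm x \<le> norm (riesz x) * norm x"
    using norm_blinfun[of "riesz x" x] by (simp add: norm_eq_sqrt_inner)
  then show "norm x \<le> norm (riesz x)"
    by (cases "x = 0") auto
qed

lemma inj_riesz: "inj (blinfun_apply riesz)"
proof (rule injI)
  fix x y :: 'a assume "riesz x = riesz y"
  then have "riesz (x - y) = 0" by (simp add: blinfun.diff_right)
  then have "norm (x - y) = 0" using norm_riesz_apply[of "x - y"] by simp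
  then show "x = y" by simp
qed

lemma surj_riesz: "surj (blinfun_apply (riesz :: 'a::{real_inner,complete_space} \<Rightarrow>\<^sub>L 'a dual))"
proof -
  have "\<exists>x. riesz x = f" for f :: "'a dual"
  proof -
    \<comment> \<open>Minimise the quadratic functional whose Euler equation is \<open>x \<bullet> h = f h\<close>.\<close>
    define J where "J x = (norm x)\<^sup>2 / 2 - f x" for x
    define m where "m = Inf (range J)"
    have lower: "- (norm f)\<^sup>2 / 2 \<le> J x" for x
    proof -
      have "f x \<le> norm f * norm x" using norm_blinfun[of f x] by simp
      moreover have "0 \<le> (norm x - norm f)\<^sup>2" by simp
      ultimately show ?thesis unfolding J_def by (simp add: power2_diff field_simps)
    qed
    have bdd: "bdd_below (range J)" by (rule bdd_belowI2) (rule lower)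
    have m_le: "m \<le> J x" for x unfolding m_def by (rule cInf_lower[OF _ bdd]) simp
    have "\<exists>x. J x < m + 1 / real (Suc n)" for n
      using cInf_lessD[of "range J" "m + 1 / real (Suc n)"] unfolding m_def by auto
    then obtain X where X: "\<And>n. J (X n) < m + 1 / real (Suc n)" by metis
    have para: "(norm (x - y))\<^sup>2 = 4 * (J x + J y - 2 * J ((1/2) *\<^sub>R (x + y)))" for x y
      unfolding J_def power2_norm_eq_inner
      by (simp add: blinfun.add_right blinfun.scaleR_right inner_simps inner_commute field_simps)
    have close: "(norm (X i - X j))\<^sup>2 < 4 * (1 / real (Suc i) + 1 / real (Suc j))" for i j
    proof -
      have "J (X i) + J (X j) - 2 * J ((1/2) *\<^sub>R (X i + X j)) < 1 / real (Suc i) + 1 / real (Suc j)"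
        using add_strict_mono[OF X[of i] X[of j]] m_le[of "(1/2) *\<^sub>R (X i + X j)"] by argo
      then show ?thesis unfolding para by simp
    qed
    have "Cauchy X"
    proof (rule metric_CauchyI)
      fix e :: real assume e: "0 < e"
      obtain N where N: "8 / e\<^sup>2 < real N" using reals_Archimedean2 by blast
      have "dist (X i) (X j) < e" if ij: "N \<le> i" "N \<le> j" for i j
      proof -
        have pos: "0 < real N" using N e by (smt (verit) divide_nonneg_nonneg zero_le_power2)
        have b: "1 / real (Suc k) \<le> 1 / real N" if "N \<le> k" for k
          using that pos by (intro divide_left_mono) auto
        have "(norm (X i - X j))\<^sup>2 < 8 / real N"
          using close[of i j] add_mono[OF b[OF ij(1)] b[OF ij(2)]] by argo
        also have "\<dots> < e\<^sup>2" using N pos e by (simp add: field_simps)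
        finally show ?thesis using e by (simp add: dist_norm power2_less_imp_less)
      qed
      then show "\<exists>M. \<forall>i\<ge>M. \<forall>j\<ge>M. dist (X i) (X j) < e" by blast
    qed
    then obtain x where x: "X \<longlonglongrightarrow> x" using Cauchy_convergent convergent_def by blast
    have "(\<lambda>n. J (X n)) \<longlonglongrightarrow> J x" unfolding J_def by (intro tendsto_intros x) simp
    moreover have "(\<lambda>n. m + 1 / real (Suc n)) \<longlonglongrightarrow> m + 0"
      by (intro tendsto_intros LIMSEQ_Suc lim_1_over_n)
    ultimately have "J x \<le> m + 0"
      by (rule LIMSEQ_le) (use X less_imp_le in blast)
    then have min: "J x \<le> J y" for y using m_le[of y] by linarith
    have "x \<bullet> h = f h" for h
    proof (cases "h = 0")
      case False
      define d where "d = x \<bullet> h - f h"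
      define s where "s = h \<bullet> h"
      have s: "0 < s" using False by (simp add: s_def)
      have "J (x - t *\<^sub>R h) = J x - t * d + t\<^sup>2 * s / 2" for t
        unfolding J_def power2_norm_eq_inner d_def s_def
        by (simp add: blinfun.diff_right blinfun.scaleR_right inner_simps inner_commute
            power2_eq_square field_simps)
      then have "J (x - (d / s) *\<^sub>R h) = J x - (d / s) * d + (d / s)\<^sup>2 * s / 2" .
      also have "\<dots> = J x - d\<^sup>2 / (2 * s)" using s by (simp add: field_simps power2_eq_square)
      finally have "d\<^sup>2 / (2 * s) \<le> 0" using min[of "x - (d / s) *\<^sub>R h"] by linarith
      then have "d = 0" using s by (simp add: divide_le_0_iff)
      then show ?thesis by (simp add: d_def)
    qed simp
    then have "riesz x = f" by (intro blinfun_eqI) simp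
    then show ?thesis ..
  qed
  then show ?thesis by (metis surjI)
qed

lift_definition riesz_inv :: "'a::{real_inner,complete_space} dual \<Rightarrow>\<^sub>L 'a"
  is "inv (blinfun_apply riesz)"
proof (rule bounded_linear_intro[where K = 1])
  note [simp] = surj_f_inv_f[OF surj_riesz]
  fix f g :: "'a dual" and c :: real
  show "inv (blinfun_apply riesz) (f + g) = inv (blinfun_apply riesz) f + inv (blinfun_apply riesz) g"
    by (rule injD[OF inj_riesz]) (simp add: blinfun.add_right)
  show "inv (blinfun_apply riesz) (c *\<^sub>R f) = c *\<^sub>R inv (blinfun_apply riesz) f"
    by (rule injD[OF inj_riesz]) (simp add: blinfun.scaleR_right)
  show "norm (inv (blinfun_apply riesz) f) \<le> norm f * 1"
    using norm_riesz_apply[of "inv (blinfun_apply riesz) f"] by simp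
qed

lemma riesz_riesz_inv [simp]: "riesz (riesz_inv f) = f"
  by (simp add: riesz_inv.rep_eq surj_f_inv_f[OF surj_riesz])

lemma riesz_inv_riesz [simp]: "riesz_inv (riesz x) = x"
  by (simp add: riesz_inv.rep_eq inv_f_f[OF inj_riesz])

lemma inner_riesz_inv [simp]: "riesz_inv f \<bullet> x = f x"
  by (metis riesz_apply riesz_riesz_inv)

lemma norm_riesz_inv [simp]: "norm (riesz_inv f) = norm f"
  using norm_riesz_apply[of "riesz_inv f"] by simp

subsection \<open>Adjoints\<close>

text \<open>For \<open>T : X \<rightarrow> O\<close> the adjoint is the pullback \<open>O' \<rightarrow> X'\<close>; for \<open>B : X \<rightarrow> Z'\<close> it is regarded
  as an operator \<open>Z \<rightarrow> X'\<close>, i.e. precomposed with the evaluation map of \<open>Z\<close> into its bidual.\<close>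

lift_definition dual_map ::
  "('a::real_normed_vector \<Rightarrow>\<^sub>L 'b::real_normed_vector) \<Rightarrow> 'b dual \<Rightarrow>\<^sub>L 'a dual"
  is "\<lambda>T \<phi>. \<phi> o\<^sub>L T"
  by (intro bounded_linear_intros)

lift_definition adj ::
  "('a::real_normed_vector \<Rightarrow>\<^sub>L ('b::real_normed_vector) dual) \<Rightarrow> 'b \<Rightarrow>\<^sub>L 'a dual"
  is "\<lambda>B z. blinfun.prod_left z o\<^sub>L B"
  by (intro bounded_linear_intros)

lemma dual_map_apply [simp]: "dual_map T \<phi> x = \<phi> (T x)"
  by (simp add: dual_map.rep_eq)

lemma adj_apply [simp]: "adj B z x = B x z"
  by (simp add: adj.rep_eq)

definition self_adjoint :: "('a::real_normed_vector \<Rightarrow>\<^sub>L 'a dual) \<Rightarrow> bool"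
  where "self_adjoint A \<longleftrightarrow> (\<forall>x y. A y x = A x y)"

definition isomorphism :: "('a::real_normed_vector \<Rightarrow>\<^sub>L 'b::real_normed_vector) \<Rightarrow> bool"
  where "isomorphism A \<longleftrightarrow> bij (blinfun_apply A) \<and> bounded_linear (inv (blinfun_apply A))"

subsection \<open>Identification of products of duals with duals of products\<close>

lift_definition pair_dual ::
  "(('a::real_normed_vector) dual \<times> ('b::real_normed_vector) dual) \<Rightarrow>\<^sub>L ('a \<times> 'b) dual"
  is "\<lambda>(f, g). (f o\<^sub>L fst_blinfun) + (g o\<^sub>L snd_blinfun)"
  unfolding case_prod_unfold by (intro bounded_linear_intros)

lemma pair_dual_apply [simp]: "pair_dual (f, g) (x, y) = f x + g y"
  by (simp add: pair_dual.rep_eq blinfun.add_left fst_blinfun.rep_eq snd_blinfun.rep_eq)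

lemma norm_pair_dual:
  fixes f :: "('a::{real_inner,complete_space}) dual" and g :: "('b::{real_inner,complete_space}) dual"
  shows "norm (pair_dual (f, g)) = sqrt ((norm f)\<^sup>2 + (norm g)\<^sup>2)"
proof -
  have "pair_dual (f, g) = riesz (riesz_inv f, riesz_inv g)"
    by (rule blinfun_eqI) auto
  then show ?thesis by (simp add: norm_Pair)
qed

subsection \<open>The operators \<open>K\<close>, \<open>\<A>\<close> and \<open>\<P>\<close>\<close>

lift_definition K_op ::
  "('y::real_normed_vector \<Rightarrow>\<^sub>L ('u::real_normed_vector) dual) \<Rightarrow>
   ('y \<Rightarrow>\<^sub>L ('r::real_normed_vector) dual) \<Rightarrow> 'y \<Rightarrow>\<^sub>L ('u \<times> 'r) dual"
  is "\<lambda>KU KR y. pair_dual (KU y, KR y)"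
  by (intro bounded_linear_intros)

lemma norm_K_op:
  fixes KU :: "'y::real_normed_vector \<Rightarrow>\<^sub>L ('u::{real_inner,complete_space}) dual"
    and KR :: "'y \<Rightarrow>\<^sub>L ('r::{real_inner,complete_space}) dual"
  shows "norm (K_op KU KR y) = sqrt ((norm (KU y))\<^sup>2 + (norm (KR y))\<^sup>2)"
  by (simp add: K_op.rep_eq norm_pair_dual)

abbreviation dual4 ::
  "('a::real_normed_vector) dual \<Rightarrow> ('b::real_normed_vector) dual \<Rightarrow>
   ('c::real_normed_vector) dual \<Rightarrow> ('d::real_normed_vector) dual \<Rightarrow> ('a \<times> 'b \<times> 'c \<times> 'd) dual"
  where "dual4 f g h k \<equiv> pair_dual (f, pair_dual (g, pair_dual (h, k)))"

lift_definition A_op ::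
  "real \<Rightarrow> ('y::real_inner \<Rightarrow>\<^sub>L 'o::real_inner) \<Rightarrow>
   ('y \<Rightarrow>\<^sub>L ('u::real_inner) dual) \<Rightarrow> ('y \<Rightarrow>\<^sub>L ('r::real_inner) dual) \<Rightarrow>
   ('u \<times> 'u \<times> 'y \<times> 'r) \<Rightarrow>\<^sub>L ('u \<times> 'u \<times> 'y \<times> 'r) dual"
  is "\<lambda>\<alpha> T KU KR (u, p, y, r). dual4
        (\<alpha> *\<^sub>R riesz u + riesz p)
        (riesz u + blinfun_apply KU y)
        (adj KU p + dual_map T (riesz (blinfun_apply T y)) + adj KR r)
        (blinfun_apply KR y)"
  unfolding case_prod_unfold by (intro bounded_linear_intros)

lift_definition P_op ::
  "real \<Rightarrow> ('y::real_inner \<Rightarrow>\<^sub>L 'o::real_inner) \<Rightarrow>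
   ('y \<Rightarrow>\<^sub>L ('u::{real_inner,complete_space}) dual) \<Rightarrow>
   ('y \<Rightarrow>\<^sub>L ('r::{real_inner,complete_space}) dual) \<Rightarrow>
   ('u \<times> 'u \<times> 'y \<times> 'r) \<Rightarrow>\<^sub>L ('u \<times> 'u \<times> 'y \<times> 'r) dual"
  is "\<lambda>\<alpha> T KU KR (u, p, y, r). dual4
        (\<alpha> *\<^sub>R riesz u)
        (inverse \<alpha> *\<^sub>R riesz p)
        (dual_map T (riesz (blinfun_apply T y)) + \<alpha> *\<^sub>R adj KU (riesz_inv (blinfun_apply KU y)) + adj KR (riesz_inv (blinfun_apply KR y)))
        (riesz r)"
  unfolding case_prod_unfold by (intro bounded_linear_intros)

lemma A_op_apply:
  "A_op \<alpha> T KU KR (u, p, y, r) (v, q, z, s) =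
     (\<alpha> * (u \<bullet> v) + p \<bullet> v) + (u \<bullet> q + KU y q) + (KU z p + T y \<bullet> T z + KR z r) + KR y s"
  by (simp add: A_op.rep_eq blinfun.add_left blinfun.scaleR_left)

lemma P_op_apply:
  "P_op \<alpha> T KU KR (u, p, y, r) (v, q, z, s) =
     \<alpha> * (u \<bullet> v) + inverse \<alpha> * (p \<bullet> q)
     + (T y \<bullet> T z + \<alpha> * KU z (riesz_inv (KU y)) + KR z (riesz_inv (KR y)))
     + r \<bullet> s"
  by (simp add: P_op.rep_eq blinfun.add_left blinfun.scaleR_left)

subsection \<open>Inner products and inf-sup conditions\<close>

definition op_norm :: "('x::real_normed_vector \<Rightarrow>\<^sub>L 'x dual) \<Rightarrow> 'x \<Rightarrow> real"
  where "op_norm P x = sqrt (P x x)"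

text \<open>\<open>(x, y) \<mapsto> \<langle>P x, y\<rangle>\<close> is an inner product (bilinearity being automatic) and its norm is complete.\<close>

definition hilbert_inner_product :: "('x::real_normed_vector \<Rightarrow>\<^sub>L 'x dual) \<Rightarrow> bool"
  where "hilbert_inner_product P \<longleftrightarrow>
    (\<forall>x y. P x y = P y x) \<and> (\<forall>x. x \<noteq> 0 \<longrightarrow> 0 < P x x) \<and>
    Metric_space.mcomplete UNIV (\<lambda>x y. op_norm P (x - y))"

definition two_sided_bound ::
  "('x::real_normed_vector \<Rightarrow>\<^sub>L 'x dual) \<Rightarrow> ('x \<Rightarrow>\<^sub>L 'x dual) \<Rightarrow> real \<Rightarrow> real \<Rightarrow> bool"
  where "two_sided_bound P A c C \<longleftrightarrow>
    (\<forall>x. c * op_norm P x \<le> op_norm P (inv (blinfun_apply P) (A x)) \<and>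
         op_norm P (inv (blinfun_apply P) (A x)) \<le> C * op_norm P x)"

text \<open>The supremum over \<open>0 \<noteq> y \<in> V\<close>, with value \<open>0\<close> if \<open>V = {0}\<close>. When \<open>V\<close> is a nontrivial subspace
  the inserted \<open>0\<close> is irrelevant; it makes the condition correct also when \<open>V\<close> and the space of
  the \<open>r\<close> are both trivial.\<close>

definition inf_sup_on ::
  "('y::real_normed_vector) set \<Rightarrow> ('y \<Rightarrow>\<^sub>L ('r::real_normed_vector) dual) \<Rightarrow> real \<Rightarrow> bool"
  where "inf_sup_on V B c \<longleftrightarrow>
    (\<forall>r. c * norm r \<le> Sup (insert 0 {B y r / norm y | y. y \<in> V \<and> y \<noteq> 0}))"

definition ker :: "('a::real_normed_vector \<Rightarrow>\<^sub>L 'b::real_normed_vector) \<Rightarrow> 'a set"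
  where "ker B = {x. B x = 0}"

end

theory Submission
  imports Defs
begin

text \<open>
  Two facts carry the theorem: an a priori estimate in the energy norm of \<open>\<P>\<close>, and
  surjectivity with a bounded right inverse as the consequence of an inf-sup condition.

  \<^bold>\<open>The energy map.\<close> Write \<open>B = \<I>\<^sub>U\<^sup>-\<^sup>1 K\<^sub>U\<close> and \<open>C = \<I>\<^sub>R\<^sup>-\<^sup>1 K\<^sub>R\<close>. With
  \<open>F (u, p, y, r) = (\<alpha>\<^sup>1\<^sup>/\<^sup>2 u, \<alpha>\<^sup>-\<^sup>1\<^sup>/\<^sup>2 p, T y, \<alpha>\<^sup>1\<^sup>/\<^sup>2 B y, C y, r)\<close> one has
  \<open>\<langle>\<P> x, x'\<rangle> = F x \<bullet> F x'\<close> and \<open>\<langle>\<A> x, x'\<rangle> = J (F x) \<bullet> F x'\<close>, where \<open>J\<close> does not depend on \<open>\<alpha>\<close>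
  and has norm at most 2. As \<open>\<P>\<inverse> \<A> x\<close> represents \<open>\<A> x\<close> in the inner product of \<open>\<P>\<close>, its norm
  is the norm of \<open>\<A> x\<close> dual to that of \<open>\<P>\<close>, so the upper bound holds with constant 2. The
  parameter cancels because the powers of \<open>\<alpha>\<close> are distributed symmetrically over the couplings.

  \<^bold>\<open>The lower bound.\<close> Let \<open>\<langle>\<A> x, x'\<rangle> \<le> \<delta> \<parallel>x'\<parallel>\<close> for all \<open>x'\<close>, in the norm of \<open>\<P>\<close>. Testing with
  \<open>(0, \<alpha> (u + B y), 0, C y)\<close> bounds the two constraints by \<open>\<delta>\<close>. Testing with \<open>(u, - p, y, - r)\<close>
  cancels all couplings and bounds \<open>\<alpha> \<parallel>u\<parallel>\<^sup>2 + \<parallel>T y\<parallel>\<^sup>2\<close> by \<open>\<delta> \<parallel>x\<parallel>\<close>. The multipliers are controlled by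
  testing with \<open>(\<alpha>\<inverse> p - B z, 0, z, 0)\<close>, where \<open>C z = r\<close> and \<open>\<parallel>z\<parallel> \<le> M \<parallel>r\<parallel>\<close>. When the norm of
  this test vector is compared with the multiplier norm \<open>(\<alpha>\<inverse> \<parallel>p\<parallel>\<^sup>2 + \<parallel>r\<parallel>\<^sup>2)\<^sup>1\<^sup>/\<^sup>2\<close>, the only
  term that is sensitive to \<open>\<alpha>\<close> is \<open>\<alpha> \<parallel>B z\<parallel>\<^sup>2\<close>. Relative to \<open>\<parallel>r\<parallel>\<^sup>2\<close> it is bounded uniformly for \<open>\<alpha> \<le> 1\<close>;
  it vanishes when \<open>z\<close> can be chosen in the kernel of \<open>K\<^sub>U\<close>, and then all \<open>\<alpha> > 0\<close> are
  covered. Combining the three estimates gives a quadratic inequality for \<open>\<parallel>x\<parallel>\<close>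
  (\<open>op_norm_le_residual\<close>).

  \<^bold>\<open>Surjectivity.\<close> An inf-sup condition makes one gradient step reduce the residual of an equation
  \<open>S y = f\<close> by a fixed factor, and iterating it yields a solution with \<open>\<parallel>y\<parallel> \<le> L \<parallel>f\<parallel>\<close>
  (\<open>inf_sup_on_imp_bounded_right_inverse\<close>). Conversely, a surjective operator satisfies an
  inf-sup condition by the uniform boundedness principle. A self-adjoint operator that is bounded
  below satisfies an inf-sup condition, so it is onto and hence an isomorphism. For \<open>\<P>\<close> this lower bound is
  coercivity, which is where \<open>\<parallel>y\<parallel> \<le> c\<^sub>K \<parallel>K y\<parallel>\<close> enters; for \<open>\<A>\<close> it follows from the a
  priori estimate and the coercivity of \<open>\<P>\<close>.
\<close>

section \<open>Convergence of geometrically controlled sequences\<close>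

lemma geometric_limit:
  fixes y :: "nat \<Rightarrow> 'a::{real_normed_vector,complete_space}"
  assumes q: "0 \<le> q" "q < 1" and step: "\<And>n. norm (y (Suc n) - y n) \<le> a * q ^ n"
  obtains l where "y \<longlonglongrightarrow> l" "\<And>n. norm (l - y n) \<le> a / (1 - q) * q ^ n"
proof -
  define K where "K = a / (1 - q)"
  have a: "0 \<le> a" using order_trans[OF norm_ge_zero step[of 0]] by simp
  have K: "0 \<le> K" unfolding K_def using a q by simp
  have aK: "a = K * (1 - q)" unfolding K_def using q by simp
  \<comment> \<open>The right-hand side is \<open>\<Sum>i=n..<n+k. a * q ^ i\<close> in closed form.\<close>
  have tele: "norm (y (n + k) - y n) \<le> K * (q ^ n - q ^ (n + k))" for n k
  proof (induction k)
    case (Suc k)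
    have "norm (y (n + Suc k) - y n) \<le> norm (y (Suc (n + k)) - y (n + k)) + norm (y (n + k) - y n)"
      using norm_triangle_ineq[of "y (Suc (n + k)) - y (n + k)" "y (n + k) - y n"] by simp
    also have "\<dots> \<le> a * q ^ (n + k) + K * (q ^ n - q ^ (n + k))"
      using step[of "n + k"] Suc by simp
    also have "\<dots> = K * (q ^ n - q ^ (n + Suc k))"
      unfolding aK by (simp add: algebra_simps)
    finally show ?case .
  qed simp
  have tail: "norm (y (n + k) - y n) \<le> K * q ^ n" for n k
  proof -
    have "K * (q ^ n - q ^ (n + k)) \<le> K * q ^ n"
      using K q by (intro mult_left_mono) auto
    with tele[of n k] show ?thesis by linarith
  qed
  have "Cauchy y"
  proof (rule CauchyI')
    fix e :: real assume e: "0 < e"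
    have "(\<lambda>n. K * q ^ n) \<longlonglongrightarrow> K * 0"
      using q by (intro tendsto_intros LIMSEQ_power_zero) auto
    then have "\<forall>\<^sub>F n in sequentially. K * q ^ n < e"
      using e by (auto dest: order_tendstoD(2))
    then obtain N where N: "\<And>n. N \<le> n \<Longrightarrow> K * q ^ n < e"
      by (auto simp: eventually_sequentially)
    have "dist (y m) (y n) < e" if "N \<le> m" "m < n" for m n
      using tail[of m "n - m"] N[of m] that by (simp add: dist_norm norm_minus_commute)
    then show "\<exists>M. \<forall>m\<ge>M. \<forall>n>m. dist (y m) (y n) < e" by blast
  qed
  then obtain l where l: "y \<longlonglongrightarrow> l" using Cauchy_convergent convergent_def by blast
  have "norm (l - y n) \<le> K * q ^ n" for n
  proof (rule LIMSEQ_le_const2)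
    show "(\<lambda>k. norm (y (n + k) - y n)) \<longlonglongrightarrow> norm (l - y n)"
      using LIMSEQ_ignore_initial_segment[OF l, of n] by (intro tendsto_intros) (simp add: add.commute)
    show "\<exists>N. \<forall>k\<ge>N. norm (y (n + k) - y n) \<le> K * q ^ n" using tail by blast
  qed
  with l show ?thesis using that unfolding K_def by blast
qed

section \<open>Surjectivity and inf-sup conditions\<close>

text \<open>
  The uniform boundedness principle for functionals represented by vectors, by a gliding hump.
  If \<open>S\<close> were unbounded, take \<open>s\<^sub>n \<in> S\<close> with \<open>\<parallel>s\<^sub>n\<parallel> > 4\<^sup>n\<close> and move by \<open>\<plusminus> 3\<^sup>-\<^sup>n s\<^sub>n / \<parallel>s\<^sub>n\<parallel>\<close> at stage
  \<open>n\<close>, with the sign that does not decrease \<open>\<bar>x \<bullet> s\<^sub>n\<bar>\<close>. All later moves together have length at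
  most half of \<open>3\<^sup>-\<^sup>n\<close>, so the limit \<open>l\<close> keeps \<open>\<bar>l \<bullet> s\<^sub>n\<bar> \<ge> (4/3)\<^sup>n / 2\<close>, which is
  unbounded.
\<close>
lemma pointwise_bounded_imp_bounded:
  fixes S :: "'a::{real_inner,complete_space} set"
  assumes "\<And>x. \<exists>K. \<forall>s\<in>S. \<bar>x \<bullet> s\<bar> \<le> K"
  shows "\<exists>L>0. \<forall>s\<in>S. norm s \<le> L"
proof (rule ccontr)
  assume "\<not> ?thesis"
  then have unb: "\<exists>s\<in>S. L < norm s" if "0 < L" for L :: real
    using that by (metis not_le)
  have "\<exists>s\<in>S. 4 ^ n < norm s" for n :: nat by (rule unb) simp
  then obtain s where s: "\<And>n. s n \<in> S" "\<And>n. 4 ^ n < norm (s n)" by metis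
  have s0: "0 < norm (s n)" for n :: nat
    using s(2)[of n] by (rule less_trans[rotated]) simp
  have step: "\<exists>z. norm (z - x) \<le> 1 * (1 / 3) ^ n \<and> (1 / 3) ^ n * norm (s n) \<le> \<bar>z \<bullet> s n\<bar>" for x n
  proof -
    define h where "h = ((1 / 3) ^ n / norm (s n)) *\<^sub>R s n"
    have nh: "norm h = (1 / 3) ^ n" unfolding h_def using s0[of n] by simp
    have hs: "h \<bullet> s n = (1 / 3) ^ n * norm (s n)"
      unfolding h_def using s0[of n] by (simp add: dot_square_norm power2_eq_square)
    have pos: "0 \<le> (1 / 3) ^ n * norm (s n)" by simp
    show ?thesis
    proof (cases "0 \<le> x \<bullet> s n")
      case True
      with hs pos have "(1 / 3) ^ n * norm (s n) \<le> \<bar>(x + h) \<bullet> s n\<bar>"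
        by (simp add: inner_add_left)
      then show ?thesis using nh by (intro exI[of _ "x + h"]) simp
    next
      case False
      with hs pos have "(1 / 3) ^ n * norm (s n) \<le> \<bar>(x - h) \<bullet> s n\<bar>"
        by (simp add: inner_diff_left)
      then show ?thesis using nh by (intro exI[of _ "x - h"]) simp
    qed
  qed
  then obtain z where z: "\<And>x n. norm (z x n - x) \<le> 1 * (1 / 3) ^ n"
    "\<And>x n. (1 / 3) ^ n * norm (s n) \<le> \<bar>z x n \<bullet> s n\<bar>" by metis
  define x where "x = rec_nat 0 (\<lambda>n a. z a n)"
  have xS: "x (Suc n) = z (x n) n" for n by (simp add: x_def)
  have "norm (x (Suc n) - x n) \<le> 1 * (1 / 3) ^ n" for n
    unfolding xS by (rule z(1))
  then obtain l where l: "\<And>n. norm (l - x n) \<le> 1 / (1 - 1 / 3) * (1 / 3) ^ n"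
    by (rule geometric_limit[rotated 2]) auto
  obtain K where K: "\<And>n. \<bar>l \<bullet> s n\<bar> \<le> K" using assms[of l] s(1) by blast
  have "(1 / 2) * (4 / 3) ^ n \<le> K" for n
  proof -
    have "\<bar>(l - x (Suc n)) \<bullet> s n\<bar> \<le> norm (l - x (Suc n)) * norm (s n)"
      by (rule Cauchy_Schwarz_ineq2)
    also have "\<dots> \<le> ((1 / 2) * (1 / 3) ^ n) * norm (s n)"
      using l[of "Suc n"] by (intro mult_right_mono) auto
    finally have "(1 / 2) * (1 / 3) ^ n * norm (s n) \<le> \<bar>l \<bullet> s n\<bar>"
      using z(2)[of n "x n"] unfolding xS inner_diff_left by linarith
    moreover have "(1 / 2) * (1 / 3) ^ n * 4 ^ n \<le> (1 / 2) * (1 / 3) ^ n * norm (s n)"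
      using s(2)[of n] by (intro mult_left_mono) auto
    moreover have "(1 / 2 :: real) * (1 / 3) ^ n * 4 ^ n = (1 / 2) * (4 / 3) ^ n"
      by (simp add: power_divide)
    ultimately show ?thesis using K[of n] by linarith
  qed
  moreover obtain n where "2 * K < (4 / 3 :: real) ^ n"
    using real_arch_pow[of "4 / 3" "2 * K"] by auto
  ultimately show False using linorder_not_less[of "2 * K" "(4 / 3) ^ n"] by (simp add: field_simps)
qed

text \<open>Suprema of reals are meaningful only for bounded sets; this makes those in \<open>inf_sup_on\<close> usable.\<close>
lemma inf_sup_quotients_bdd_above:
  fixes B :: "'y::real_normed_vector \<Rightarrow>\<^sub>L ('r::real_normed_vector) dual"
  shows "bdd_above (insert 0 {B y r / norm y | y. y \<in> V \<and> y \<noteq> 0})"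
proof (rule bdd_aboveI)
  fix a assume "a \<in> insert 0 {B y r / norm y | y. y \<in> V \<and> y \<noteq> 0}"
  then consider "a = 0" | y where "a = B y r / norm y" "y \<noteq> 0" by blast
  then show "a \<le> norm B * norm r"
  proof cases
    case 2
    have "B y r \<le> norm (B y) * norm r" using norm_blinfun[of "B y" r] by simp
    also have "\<dots> \<le> norm B * norm y * norm r"
      by (intro mult_right_mono norm_blinfun) simp
    finally show ?thesis using 2 by (simp add: pos_divide_le_eq mult_ac)
  qed simp
qed

text \<open>By symmetry the inf-sup quotients of \<open>x\<close> are \<open>A x y / \<parallel>y\<parallel>\<close>, and their supremum is the dual norm of
  \<open>A x\<close>.\<close>
lemma inf_sup_on_UNIV_of_bounded_below:
  fixes A :: "'x::real_normed_vector \<Rightarrow>\<^sub>L 'x dual"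
  assumes "self_adjoint A" and "\<And>x. c * norm x \<le> norm (A x)"
  shows "inf_sup_on UNIV A c"
  unfolding inf_sup_on_def
proof
  fix x
  let ?Q = "insert 0 {A y x / norm y | y. y \<in> UNIV \<and> y \<noteq> 0}"
  have ub: "q \<in> ?Q \<Longrightarrow> q \<le> Sup ?Q" for q
    by (rule cSup_upper[OF _ inf_sup_quotients_bdd_above])
  have le: "A x y \<le> Sup ?Q * norm y" for y
  proof (cases "y = 0")
    case False
    then have "A y x / norm y \<le> Sup ?Q" by (intro ub) auto
    then show ?thesis using False assms(1)
      by (simp add: self_adjoint_def divide_simps)
  qed simp
  have "norm (A x) \<le> Sup ?Q"
  proof (rule norm_blinfun_bound)
    show "0 \<le> Sup ?Q" by (rule ub) simp
    show "norm (A x y) \<le> Sup ?Q * norm y" for y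
      using le[of y] le[of "- y"] by (simp add: blinfun.minus_right abs_le_iff)
  qed
  with assms(2)[of x] show "c * norm x \<le> Sup ?Q" by linarith
qed

text \<open>
  Let \<open>S\<close> consist of the vectors whose inf-sup quotients are at most 1. Testing with preimages under
  \<open>B\<close> of all functionals shows that \<open>S\<close> is pointwise bounded, hence norm bounded by some \<open>L\<close>. A
  vector \<open>r\<close> divided by any number above the supremum of its quotients lies in \<open>S\<close>, so the
  supremum is at least \<open>\<parallel>r\<parallel> / L\<close>.
\<close>
lemma surjective_imp_inf_sup_on:
  fixes B :: "'y::real_normed_vector \<Rightarrow>\<^sub>L ('r::{real_inner,complete_space}) dual"
  assumes "subspace V" and surj: "blinfun_apply B ` V = UNIV"
  shows "\<exists>c>0. inf_sup_on V B c"
proof -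
  define S where "S = {s. \<forall>y\<in>V. B y s \<le> norm y}"
  have "\<exists>K. \<forall>s\<in>S. \<bar>x \<bullet> s\<bar> \<le> K" for x
  proof -
    have "riesz x \<in> blinfun_apply B ` V" using surj by simp
    then obtain y where y: "y \<in> V" "B y = riesz x" by auto
    have "\<bar>x \<bullet> s\<bar> \<le> norm y" if "s \<in> S" for s
    proof -
      have "B y s \<le> norm y" "B (- y) s \<le> norm (- y)"
        using that y(1) subspace_neg[OF assms(1) y(1)] unfolding S_def by blast+
      then show ?thesis using y(2) by (simp add: blinfun.minus_right blinfun.minus_left)
    qed
    then show ?thesis by blast
  qed
  from pointwise_bounded_imp_bounded[OF this]
  obtain L where L: "0 < L" "\<And>s. s \<in> S \<Longrightarrow> norm s \<le> L" by blast
  have "inf_sup_on V B (1 / L)"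
    unfolding inf_sup_on_def
  proof
    fix r
    let ?Q = "insert 0 {B y r / norm y | y. y \<in> V \<and> y \<noteq> 0}"
    have ub: "q \<in> ?Q \<Longrightarrow> q \<le> Sup ?Q" for q
      by (rule cSup_upper[OF _ inf_sup_quotients_bdd_above])
    have Q0: "0 \<le> Sup ?Q" by (rule ub) simp
    have "norm r / L \<le> Sup ?Q + e" if e: "0 < e" for e
    proof -
      define m where "m = Sup ?Q + e"
      have m: "0 < m" using Q0 e by (simp add: m_def)
      have "B y r \<le> m * norm y" if "y \<in> V" for y
      proof (cases "y = 0")
        case False
        then have "B y r / norm y \<le> Sup ?Q" using that by (intro ub) auto
        then have "B y r / norm y \<le> m" using e by (simp add: m_def)
        then show ?thesis using False by (simp add: divide_simps)
      qed simp
      then have "(1 / m) *\<^sub>R r \<in> S"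
        unfolding S_def using m by (simp add: blinfun.scaleR_right divide_simps mult.commute)
      from L(2)[OF this] have "norm r \<le> L * m" using m by (simp add: divide_simps)
      then show ?thesis using L(1) by (simp add: m_def divide_simps mult.commute)
    qed
    then have "norm r / L \<le> Sup ?Q" by (rule field_le_epsilon)
    then show "1 / L * norm r \<le> Sup ?Q" by simp
  qed
  with L(1) show ?thesis by (intro exI[of _ "1 / L"]) simp
qed

text \<open>
  With \<open>r\<close> the Riesz representative of \<open>f\<close>, choose \<open>y \<in> V\<close> whose quotient is at least half of the
  supremum, and rescale it to norm \<open>t \<parallel>f\<parallel>\<close>. Then
  \<open>\<parallel>f - B y\<parallel>\<^sup>2 = \<parallel>f\<parallel>\<^sup>2 - 2 \<langle>B y, r\<rangle> + \<parallel>B y\<parallel>\<^sup>2 \<le> (1 - c t + M\<^sup>2 t\<^sup>2) \<parallel>f\<parallel>\<^sup>2\<close> for any \<open>M \<ge> \<parallel>B\<parallel>\<close>,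
  and \<open>t = c / (2 M\<^sup>2)\<close> minimises the factor.
\<close>
lemma inf_sup_on_descent_step:
  fixes B :: "'y::real_normed_vector \<Rightarrow>\<^sub>L ('r::{real_inner,complete_space}) dual"
  assumes V: "subspace V" and c: "0 < c" and isup: "inf_sup_on V B c"
  shows "\<exists>t q. 0 \<le> t \<and> 0 \<le> q \<and> q < 1 \<and>
    (\<forall>f. \<exists>y\<in>V. norm y \<le> t * norm f \<and> norm (f - B y) \<le> q * norm f)"
proof -
  \<comment> \<open>Adding \<open>c\<close> makes \<open>M\<close> positive even for \<open>B = 0\<close>, and \<open>M \<ge> c\<close> keeps the factor nonnegative.\<close>
  define M where "M = norm B + c"
  have M: "0 < M" "norm B \<le> M" "c \<le> M" using c norm_ge_zero[of B] unfolding M_def by linarith+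
  define t where "t = c / (2 * M\<^sup>2)"
  define q where "q = sqrt (1 - c\<^sup>2 / (4 * M\<^sup>2))"
  have t: "0 < t" unfolding t_def using c M by simp
  have c2: "c\<^sup>2 \<le> M\<^sup>2" using c M by (intro power_mono) auto
  have q: "0 \<le> 1 - c\<^sup>2 / (4 * M\<^sup>2)" "1 - c\<^sup>2 / (4 * M\<^sup>2) < 1"
  proof -
    have "c\<^sup>2 \<le> 4 * M\<^sup>2" using c2 zero_le_power2[of M] by linarith
    then have "c\<^sup>2 / (4 * M\<^sup>2) \<le> 1" using M(1) by simp
    then show "0 \<le> 1 - c\<^sup>2 / (4 * M\<^sup>2)" by simp
    show "1 - c\<^sup>2 / (4 * M\<^sup>2) < 1" using c M by simp
  qed
  have "\<exists>y\<in>V. norm y \<le> t * norm f \<and> norm (f - B y) \<le> q * norm f" for f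
  proof (cases "f = 0")
    case True
    then show ?thesis using subspace_0[OF V] by (intro bexI[of _ 0]) auto
  next
    case False
    define r where "r = riesz_inv f"
    define n where "n = norm f"
    have n: "0 < n" "norm r = n" using False by (auto simp: n_def r_def)
    let ?Q = "insert 0 {B y r / norm y | y. y \<in> V \<and> y \<noteq> 0}"
    have "c / 2 * n < c * norm r" using c n by simp
    also have "\<dots> \<le> Sup ?Q" using isup unfolding inf_sup_on_def by blast
    finally have "c / 2 * n < Sup ?Q" .
    from less_cSupD[OF insert_not_empty this] obtain a where a: "a \<in> ?Q" "c / 2 * n < a"
      by (rule bexE)
    have "0 < c / 2 * n" using c n(1) by simp
    then have "a \<noteq> 0" using a(2) by linarith
    then obtain y where y: "y \<in> V" "y \<noteq> 0" "c / 2 * n < B y r / norm y" using a by auto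
    define z where "z = (t * n / norm y) *\<^sub>R y"
    have zV: "z \<in> V" unfolding z_def by (rule subspace_scale[OF V y(1)])
    have nz: "norm z = t * n" unfolding z_def using y n t by simp
    have "t * n * (c / 2 * n) \<le> t * n * (B y r / norm y)"
      using y(3) t n by (intro mult_left_mono) auto
    also have "\<dots> = B z r" unfolding z_def by (simp add: blinfun.scaleR_right blinfun.scaleR_left)
    finally have Bzr: "t * c * n\<^sup>2 / 2 \<le> B z r" by (simp add: power2_eq_square mult_ac)
    have "norm (B z) \<le> norm B * norm z" by (rule norm_blinfun)
    also have "\<dots> \<le> M * (t * n)" unfolding nz using M t n by (intro mult_right_mono) auto
    finally have Bz: "(norm (B z))\<^sup>2 \<le> (M * (t * n))\<^sup>2" by (rule power_mono) simp
    have "(norm (f - B z))\<^sup>2 = (norm (r - riesz_inv (B z)))\<^sup>2"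
      unfolding r_def using norm_riesz_inv[of "f - B z"] by (simp add: blinfun.diff_right)
    also have "\<dots> = (norm r)\<^sup>2 - 2 * B z r + (norm (B z))\<^sup>2"
    proof -
      have "riesz_inv (B z) \<bullet> riesz_inv (B z) = (norm (B z))\<^sup>2"
        unfolding power2_norm_eq_inner[symmetric] by simp
      moreover have "r \<bullet> riesz_inv (B z) = B z r"
        by (subst inner_commute) simp
      ultimately show ?thesis
        unfolding power2_norm_eq_inner[of "r - _"] power2_norm_eq_inner[of r]
        by (simp add: inner_diff_left inner_diff_right inner_commute)
    qed
    also have "\<dots> \<le> n\<^sup>2 - t * c * n\<^sup>2 + (M * (t * n))\<^sup>2" using Bzr Bz n by simp
    also have "\<dots> = (1 - t * c + M\<^sup>2 * t\<^sup>2) * n\<^sup>2"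
      by (simp add: power_mult_distrib algebra_simps)
    also have "\<dots> = (1 - c\<^sup>2 / (4 * M\<^sup>2)) * n\<^sup>2"
    proof -
      have "t * c = 2 * (c\<^sup>2 / (4 * M\<^sup>2))" "M\<^sup>2 * t\<^sup>2 = c\<^sup>2 / (4 * M\<^sup>2)"
        unfolding t_def using M(1) by (simp_all add: power_divide power_mult_distrib power2_eq_square)
      then show ?thesis by simp
    qed
    also have "\<dots> = (q * n)\<^sup>2"
      unfolding power_mult_distrib q_def real_sqrt_pow2[OF q(1)] ..
    finally have "norm (f - B z) \<le> q * n"
      by (rule power2_le_imp_le) (use q n(1) in \<open>simp add: q_def\<close>)
    then show ?thesis using zV nz unfolding n_def by (intro bexI[of _ z]) simp_all
  qed
  moreover have "0 \<le> q" "q < 1" unfolding q_def using q by auto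
  ultimately show ?thesis using t by (intro exI[of _ t] exI[of _ q]) auto
qed

text \<open>
  The descent step is repeated on the residuals. They decay geometrically and so do the
  increments, so the iterates converge; \<open>V\<close> being closed, the limit stays in it.
\<close>
lemma inf_sup_on_imp_bounded_right_inverse:
  fixes B :: "'y::{real_normed_vector,complete_space} \<Rightarrow>\<^sub>L ('r::{real_inner,complete_space}) dual"
  assumes V: "subspace V" "closed V" and c: "0 < c" and isup: "inf_sup_on V B c"
  shows "\<exists>L\<ge>0. \<forall>f. \<exists>y\<in>V. B y = f \<and> norm y \<le> L * norm f"
proof -
  obtain t q where t: "0 \<le> t" and q: "0 \<le> q" "q < 1"
    and ex: "\<forall>f. \<exists>y. y \<in> V \<and> norm y \<le> t * norm f \<and> norm (f - B y) \<le> q * norm f"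
    using inf_sup_on_descent_step[OF V(1) c isup] unfolding Bex_def by auto
  from choice[OF ex] obtain g where gV: "\<And>f. g f \<in> V"
    and g: "\<And>f. norm (g f) \<le> t * norm f" "\<And>f. norm (f - B (g f)) \<le> q * norm f"
    by auto
  have "\<exists>y\<in>V. B y = f \<and> norm y \<le> t / (1 - q) * norm f" for f
  proof -
    define y where "y = rec_nat 0 (\<lambda>_ a. a + g (f - B a))"
    have y0: "y 0 = 0" and yS: "y (Suc n) = y n + g (f - B (y n))" for n
      by (simp_all add: y_def)
    have yV: "y n \<in> V" for n
      by (induction n) (auto simp: y0 yS subspace_0[OF V(1)] intro!: subspace_add[OF V(1)] gV)
    have res: "norm (f - B (y n)) \<le> q ^ n * norm f" for n
    proof (induction n)
      case (Suc n)
      have "norm (f - B (y (Suc n))) \<le> q * norm (f - B (y n))"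
        using g(2)[of "f - B (y n)"] by (simp add: yS blinfun.add_right diff_diff_eq)
      also have "\<dots> \<le> q * (q ^ n * norm f)" using q Suc by (intro mult_left_mono) auto
      finally show ?case by simp
    qed (simp add: y0)
    have "norm (y (Suc n) - y n) \<le> (t * norm f) * q ^ n" for n
    proof -
      have "norm (y (Suc n) - y n) \<le> t * norm (f - B (y n))" using g(1) by (simp add: yS)
      also have "\<dots> \<le> t * (q ^ n * norm f)" using t res by (intro mult_left_mono) auto
      finally show ?thesis by (simp add: mult_ac)
    qed
    from geometric_limit[OF q this] obtain l where l: "y \<longlonglongrightarrow> l"
      and bd: "\<And>n. norm (l - y n) \<le> t * norm f / (1 - q) * q ^ n" by blast
    have "l \<in> V" using V(2) yV l by (rule closed_sequentially)
    moreover have "B l = f"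
    proof -
      have "(\<lambda>n. f - B (y n)) \<longlonglongrightarrow> 0"
      proof (rule Lim_null_comparison)
        show "\<forall>\<^sub>F n in sequentially. norm (f - B (y n)) \<le> q ^ n * norm f" using res by simp
        have "(\<lambda>n. q ^ n * norm f) \<longlonglongrightarrow> 0 * norm f"
          using q by (intro tendsto_intros LIMSEQ_power_zero) auto
        then show "(\<lambda>n. q ^ n * norm f) \<longlonglongrightarrow> 0" by simp
      qed
      moreover have "(\<lambda>n. f - B (y n)) \<longlonglongrightarrow> f - B l" by (intro tendsto_intros l)
      ultimately show ?thesis using LIMSEQ_unique by fastforce
    qed
    moreover have "norm l \<le> t / (1 - q) * norm f" using bd[of 0] by (simp add: y0)
    ultimately show ?thesis by blast
  qed
  moreover have "0 \<le> t / (1 - q)" using t q by simp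
  ultimately show ?thesis by blast
qed

lemma surjective_on_iff_inf_sup_on:
  fixes B :: "'y::{real_normed_vector,complete_space} \<Rightarrow>\<^sub>L ('r::{real_inner,complete_space}) dual"
  assumes "subspace V" "closed V"
  shows "blinfun_apply B ` V = UNIV \<longleftrightarrow> (\<exists>c>0. inf_sup_on V B c)"
proof
  show "\<exists>c>0. inf_sup_on V B c" if "blinfun_apply B ` V = UNIV"
    by (rule surjective_imp_inf_sup_on[OF assms(1) that])
next
  assume "\<exists>c>0. inf_sup_on V B c"
  then have "\<forall>f. \<exists>y\<in>V. B y = f"
    using inf_sup_on_imp_bounded_right_inverse[OF assms] by blast
  then show "blinfun_apply B ` V = UNIV" by (metis UNIV_eq_I image_eqI)
qed

lemma surjective_on_imp_bounded_right_inverse: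
  fixes B :: "'y::{real_normed_vector,complete_space} \<Rightarrow>\<^sub>L ('r::{real_inner,complete_space}) dual"
  assumes "subspace V" "closed V" "blinfun_apply B ` V = UNIV"
  obtains L where "0 \<le> L" "\<And>f. \<exists>y\<in>V. B y = f \<and> norm y \<le> L * norm f"
  using surjective_imp_inf_sup_on[OF assms(1,3)] inf_sup_on_imp_bounded_right_inverse[OF assms(1,2)]
    that by blast

lemma subspace_ker: "subspace (ker B)"
  by (auto simp: subspace_def ker_def blinfun.add_right blinfun.scaleR_right)

lemma closed_ker: "closed (ker B)"
  unfolding ker_def by (intro closed_Collect_eq continuous_intros)

text \<open>The lower bound is at once injectivity, the inf-sup condition that yields surjectivity, and the
  continuity of the inverse.\<close>
lemma isomorphism_of_self_adjoint_bounded_below: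
  fixes A :: "'x::{real_inner,complete_space} \<Rightarrow>\<^sub>L 'x dual"
  assumes sa: "self_adjoint A" and c: "0 < c" and bb: "\<And>x. c * norm x \<le> norm (A x)"
  shows "isomorphism A"
proof -
  have "inj (blinfun_apply A)"
  proof (rule injI)
    fix x y assume "A x = A y"
    then have "c * norm (x - y) \<le> 0" using bb[of "x - y"] by (simp add: blinfun.diff_right)
    then show "x = y" using c by (simp add: mult_le_0_iff)
  qed
  moreover have "surj (blinfun_apply A)"
    using surjective_on_iff_inf_sup_on[of UNIV A] c inf_sup_on_UNIV_of_bounded_below[OF sa bb] by auto
  ultimately have bij: "bij (blinfun_apply A)" by (simp add: bij_def)
  then have AI [simp]: "A (inv (blinfun_apply A) f) = f" for f
    by (simp add: bij_is_surj surj_f_inv_f)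
  have "bounded_linear (inv (blinfun_apply A))"
  proof (rule bounded_linear_intro[where K = "1 / c"])
    show "inv (blinfun_apply A) (f + g) = inv (blinfun_apply A) f + inv (blinfun_apply A) g" for f g
      by (rule injD[OF bij_is_inj[OF bij]]) (simp add: blinfun.add_right)
    show "inv (blinfun_apply A) (k *\<^sub>R f) = k *\<^sub>R inv (blinfun_apply A) f" for k f
      by (rule injD[OF bij_is_inj[OF bij]]) (simp add: blinfun.scaleR_right)
    show "norm (inv (blinfun_apply A) f) \<le> norm f * (1 / c)" for f
      using bb[of "inv (blinfun_apply A) f"] c by (simp add: field_simps)
  qed
  with bij show ?thesis by (simp add: isomorphism_def)
qed


section \<open>The energy map\<close>

text \<open>The map \<open>F\<close> with \<open>F x \<bullet> F x' = \<langle>\<P> x, x'\<rangle>\<close>: it turns the energy norm into an ordinary norm on a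
  product space.\<close>
definition energy_map ::
  "real \<Rightarrow> ('y::real_inner \<Rightarrow>\<^sub>L 'o::real_inner) \<Rightarrow>
   ('y \<Rightarrow>\<^sub>L ('u::{real_inner,complete_space}) dual) \<Rightarrow>
   ('y \<Rightarrow>\<^sub>L ('r::{real_inner,complete_space}) dual) \<Rightarrow>
   'u \<times> 'u \<times> 'y \<times> 'r \<Rightarrow> 'u \<times> 'u \<times> 'o \<times> 'u \<times> 'r \<times> 'r"
  where "energy_map \<alpha> T KU KR = (\<lambda>(u, p, y, r).
    (sqrt \<alpha> *\<^sub>R u, (1 / sqrt \<alpha>) *\<^sub>R p, T y, sqrt \<alpha> *\<^sub>R riesz_inv (KU y), riesz_inv (KR y), r))"

text \<open>The operator \<open>J\<close> that represents \<open>\<A>\<close> in the coordinates of \<open>energy_map\<close>; its entries are free of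
  \<open>\<alpha>\<close>, \<open>T\<close>, \<open>K\<^sub>U\<close> and \<open>K\<^sub>R\<close>.\<close>
definition coupling ::
  "'u \<times> 'u \<times> 'o \<times> 'u \<times> 'r \<times> 'r \<Rightarrow>
   ('u::real_inner) \<times> 'u \<times> ('o::real_inner) \<times> 'u \<times> ('r::real_inner) \<times> 'r"
  where "coupling = (\<lambda>(a, b, t, k, c, r). (a + b, a + k, t, b, r, c))"

lemma norm_add_squared_le:
  fixes x y :: "'a::real_inner"
  shows "(norm (x + y))\<^sup>2 \<le> 2 * (norm x)\<^sup>2 + 2 * (norm y)\<^sup>2"
proof -
  have "(norm (x + y))\<^sup>2 + (norm (x - y))\<^sup>2 = 2 * (norm x)\<^sup>2 + 2 * (norm y)\<^sup>2"
    unfolding power2_norm_eq_inner by (simp add: inner_simps)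
  then show ?thesis using zero_le_power2[of "norm (x - y)"] by linarith
qed

lemma norm_coupling_le: "norm (coupling z) \<le> 2 * norm z"
proof -
  obtain a b t k c r where z: "z = (a, b, t, k, c, r)" by (metis surj_pair)
  have "(norm (coupling z))\<^sup>2 = (norm (a + b))\<^sup>2 + (norm (a + k))\<^sup>2
      + (norm t)\<^sup>2 + (norm b)\<^sup>2 + (norm r)\<^sup>2 + (norm c)\<^sup>2"
    unfolding z coupling_def by (simp add: norm_Pair)
  moreover have "(norm z)\<^sup>2 = (norm a)\<^sup>2 + (norm b)\<^sup>2 + (norm t)\<^sup>2 + (norm k)\<^sup>2 + (norm c)\<^sup>2 + (norm r)\<^sup>2"
    unfolding z by (simp add: norm_Pair)
  ultimately have "(norm (coupling z))\<^sup>2 \<le> 4 * (norm z)\<^sup>2"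
    using norm_add_squared_le[of a b] norm_add_squared_le[of a k]
      zero_le_power2[of "norm b"] zero_le_power2[of "norm c"] zero_le_power2[of "norm r"]
      zero_le_power2[of "norm t"] zero_le_power2[of "norm k"]
    by linarith
  then have "(norm (coupling z))\<^sup>2 \<le> (2 * norm z)\<^sup>2" by (simp add: power_mult_distrib)
  then show ?thesis by (rule power2_le_imp_le) simp
qed

lemma energy_map_diff:
  "energy_map \<alpha> T KU KR (x - y) = energy_map \<alpha> T KU KR x - energy_map \<alpha> T KU KR y"
  by (cases x; cases y)
    (simp add: energy_map_def blinfun.diff_right scaleR_diff_right)

lemma P_op_eq_inner_energy_map:
  assumes "0 < \<alpha>"
  shows "P_op \<alpha> T KU KR x y = energy_map \<alpha> T KU KR x \<bullet> energy_map \<alpha> T KU KR y"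
proof -
  obtain u p z r where x: "x = (u, p, z, r)" by (metis surj_pair)
  obtain v q w s where y: "y = (v, q, w, s)" by (metis surj_pair)
  have sqrt: "sqrt \<alpha> * (sqrt \<alpha> * a) = \<alpha> * a" for a
    unfolding mult.assoc[symmetric] using assms by simp
  have inv_sqrt: "(1 / sqrt \<alpha>) * ((1 / sqrt \<alpha>) * a) = inverse \<alpha> * a" for a
    unfolding mult.assoc[symmetric] using assms by (simp add: divide_inverse flip: inverse_mult_distrib)
  have riesz: "riesz_inv (KU z) \<bullet> riesz_inv (KU w) = KU w (riesz_inv (KU z))"
    "riesz_inv (KR z) \<bullet> riesz_inv (KR w) = KR w (riesz_inv (KR z))"
    by (subst inner_commute, simp)+
  show ?thesis
    unfolding x y P_op_apply energy_map_def
    by (simp only: prod.case inner_Pair inner_scaleR_left inner_scaleR_right sqrt inv_sqrt riesz add.assoc)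
qed

lemma A_op_eq_inner_energy_map:
  assumes "0 < \<alpha>"
  shows "A_op \<alpha> T KU KR x y = coupling (energy_map \<alpha> T KU KR x) \<bullet> energy_map \<alpha> T KU KR y"
proof -
  obtain u p z r where x: "x = (u, p, z, r)" by (metis surj_pair)
  obtain v q w s where y: "y = (v, q, w, s)" by (metis surj_pair)
  have "sqrt \<alpha> * (sqrt \<alpha> * a) = \<alpha> * a" for a using assms by (simp flip: mult.assoc)
  moreover have "sqrt \<alpha> * (a / sqrt \<alpha>) = a" for a using assms by simp
  moreover have "p \<bullet> riesz_inv (KU w) = KU w p" "r \<bullet> riesz_inv (KR w) = KR w r"
    by (subst inner_commute, simp)+
  ultimately show ?thesis
    unfolding x y A_op_apply energy_map_def coupling_def
    using assms by (simp add: inner_add_left algebra_simps)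
qed

lemma op_norm_eq_norm_energy_map:
  assumes "0 < \<alpha>"
  shows "op_norm (P_op \<alpha> T KU KR) x = norm (energy_map \<alpha> T KU KR x)"
  by (simp add: op_norm_def P_op_eq_inner_energy_map[OF assms] norm_eq_sqrt_inner)

lemma P_op_Cauchy_Schwarz:
  assumes "0 < \<alpha>"
  shows "P_op \<alpha> T KU KR x y \<le> op_norm (P_op \<alpha> T KU KR) x * op_norm (P_op \<alpha> T KU KR) y"
  unfolding P_op_eq_inner_energy_map[OF assms] op_norm_eq_norm_energy_map[OF assms]
  by (rule norm_cauchy_schwarz)

lemma A_op_le_op_norm:
  assumes "0 < \<alpha>"
  shows "A_op \<alpha> T KU KR x y \<le> 2 * op_norm (P_op \<alpha> T KU KR) x * op_norm (P_op \<alpha> T KU KR) y"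
proof -
  let ?F = "energy_map \<alpha> T KU KR"
  have "A_op \<alpha> T KU KR x y \<le> norm (coupling (?F x)) * norm (?F y)"
    unfolding A_op_eq_inner_energy_map[OF assms] by (rule norm_cauchy_schwarz)
  also have "\<dots> \<le> 2 * norm (?F x) * norm (?F y)"
    by (intro mult_right_mono norm_coupling_le) simp
  finally show ?thesis unfolding op_norm_eq_norm_energy_map[OF assms] .
qed

lemma op_norm_P_op_squared:
  assumes "0 < \<alpha>"
  shows "(op_norm (P_op \<alpha> T KU KR) (u, p, y, r))\<^sup>2 =
    \<alpha> * (norm u)\<^sup>2 + (norm p)\<^sup>2 / \<alpha> + (norm (T y))\<^sup>2 + \<alpha> * (norm (KU y))\<^sup>2 + (norm (KR y))\<^sup>2 + (norm r)\<^sup>2"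
  unfolding op_norm_eq_norm_energy_map[OF assms] energy_map_def
  using assms by (simp add: norm_Pair power_mult_distrib power_divide)

text \<open>
  The energy norm dominates \<open>u\<close>, \<open>p\<close>, \<open>r\<close> and \<open>K y\<close>, and \<open>K y\<close> dominates \<open>y\<close>. The constant
  degenerates as \<open>\<alpha>\<close> tends to 0 or to infinity. It serves only for the qualitative statements, about a
  single \<open>\<alpha>\<close>.
\<close>
lemma op_norm_coercive:
  fixes T :: "'y::{real_inner,complete_space} \<Rightarrow>\<^sub>L 'o::{real_inner,complete_space}"
    and KU :: "'y \<Rightarrow>\<^sub>L ('u::{real_inner,complete_space}) dual"
    and KR :: "'y \<Rightarrow>\<^sub>L ('r::{real_inner,complete_space}) dual"
  assumes \<alpha>: "0 < \<alpha>" and K1: "\<And>y. norm y \<le> cK * norm (K_op KU KR y)"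
  obtains g where "0 < g" "\<And>x. g * norm x \<le> op_norm (P_op \<alpha> T KU KR) x"
proof -
  define m where "m = min (min \<alpha> (1 / \<alpha>)) 1"
  have m: "0 < m" "m \<le> \<alpha>" "m \<le> 1 / \<alpha>" "m \<le> 1" using \<alpha> by (auto simp: m_def)
  define g where "g = sqrt (m / (1 + cK\<^sup>2))"
  have d: "0 < 1 + cK\<^sup>2" by (simp add: add_pos_nonneg)
  have g: "0 < g" unfolding g_def using m d by simp
  have "g * norm x \<le> op_norm (P_op \<alpha> T KU KR) x" for x
  proof -
    obtain u p y r where x: "x = (u, p, y, r)" by (metis surj_pair)
    define k where "k = (norm (KU y))\<^sup>2 + (norm (KR y))\<^sup>2"
    have "(norm y)\<^sup>2 \<le> (cK * norm (K_op KU KR y))\<^sup>2" using K1 by (rule power_mono) simp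
    then have y: "(norm y)\<^sup>2 \<le> cK\<^sup>2 * k" by (simp add: norm_K_op power_mult_distrib k_def)
    have sc: "m * (norm v)\<^sup>2 \<le> a * (norm v)\<^sup>2" if "m \<le> a" for a and v :: "'v::real_normed_vector"
      using that by (rule mult_right_mono) simp
    have "m / (1 + cK\<^sup>2) * (norm x)\<^sup>2
        = m / (1 + cK\<^sup>2) * ((norm u)\<^sup>2 + (norm p)\<^sup>2 + (norm y)\<^sup>2 + (norm r)\<^sup>2)"
      by (simp add: x norm_Pair)
    also have "\<dots> \<le> m / (1 + cK\<^sup>2) * ((1 + cK\<^sup>2) * ((norm u)\<^sup>2 + (norm p)\<^sup>2 + k + (norm r)\<^sup>2))"
    proof (rule mult_left_mono)
      have "0 \<le> cK\<^sup>2 * ((norm u)\<^sup>2 + (norm p)\<^sup>2 + (norm r)\<^sup>2)" "0 \<le> k" by (simp_all add: k_def)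
      then show "(norm u)\<^sup>2 + (norm p)\<^sup>2 + (norm y)\<^sup>2 + (norm r)\<^sup>2
          \<le> (1 + cK\<^sup>2) * ((norm u)\<^sup>2 + (norm p)\<^sup>2 + k + (norm r)\<^sup>2)"
        using y unfolding distrib_left distrib_right mult_1 mult.commute[of _ k] by linarith
    qed (use m d in simp)
    also have "\<dots> = m * (norm u)\<^sup>2 + m * (norm p)\<^sup>2 + m * (norm (KU y))\<^sup>2 + m * (norm (KR y))\<^sup>2 + m * (norm r)\<^sup>2"
    proof -
      have "m / (1 + cK\<^sup>2) * ((1 + cK\<^sup>2) * a) = m * a" for a using d by simp
      then show ?thesis by (simp only: k_def distrib_left add.assoc)
    qed
    also have "\<dots> \<le> (op_norm (P_op \<alpha> T KU KR) x)\<^sup>2"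
      unfolding x op_norm_P_op_squared[OF \<alpha>]
      using sc[OF m(2), of u] sc[OF m(3), of p] sc[OF m(2), of "KU y"] sc[OF m(4), of "KR y"]
        sc[OF m(4), of r] zero_le_power2[of "norm (T y)"]
      unfolding mult_1 times_divide_eq_left by linarith
    finally have "(g * norm x)\<^sup>2 \<le> (op_norm (P_op \<alpha> T KU KR) x)\<^sup>2"
      unfolding g_def using m d by (simp add: power_mult_distrib)
    then show ?thesis
      by (rule power2_le_imp_le) (simp add: op_norm_eq_norm_energy_map[OF \<alpha>])
  qed
  with g that show ?thesis by blast
qed

section \<open>The a priori estimate\<close>

lemma norm_apply_squared_le:
  assumes "norm z \<le> M * norm r"
  shows "(norm (blinfun_apply B z))\<^sup>2 \<le> (norm B * M)\<^sup>2 * (norm r)\<^sup>2"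
proof -
  have "norm (B z) \<le> norm B * (M * norm r)"
    using norm_blinfun[of B z] mult_left_mono[OF assms, of "norm B"] by simp
  then have "(norm (B z))\<^sup>2 \<le> (norm B * (M * norm r))\<^sup>2" by (rule power_mono) simp
  then show ?thesis by (simp add: power_mult_distrib mult.assoc)
qed

text \<open>
  The a priori estimate. The constant depends on \<open>\<alpha>\<close> only through \<open>\<beta>\<close>, a bound for the energy
  \<open>\<alpha> \<parallel>K\<^sub>U z\<parallel>\<^sup>2\<close> of a lifting \<open>z\<close> of \<open>r\<close>; this is what distinguishes the two inf-sup
  conditions on \<open>K\<^sub>R\<close>. The proof names the pieces of the energy norm: \<open>e\<^sup>2\<close> is the part that the quadratic
  form of \<open>\<A>\<close> controls, \<open>m2\<close> that of the multipliers.
\<close>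
lemma op_norm_le_residual:
  fixes T :: "'y::{real_inner,complete_space} \<Rightarrow>\<^sub>L 'o::{real_inner,complete_space}"
    and KU :: "'y \<Rightarrow>\<^sub>L ('u::{real_inner,complete_space}) dual"
    and KR :: "'y \<Rightarrow>\<^sub>L ('r::{real_inner,complete_space}) dual"
  assumes \<alpha>: "0 < \<alpha>" and \<beta>: "0 \<le> \<beta>" and \<delta>: "0 \<le> \<delta>"
    and lift: "\<And>r. \<exists>z. KR z = riesz r \<and> norm z \<le> M * norm r \<and> \<alpha> * (norm (KU z))\<^sup>2 \<le> \<beta> * (norm r)\<^sup>2"
    and res: "\<And>x'. A_op \<alpha> T KU KR x x' \<le> \<delta> * op_norm (P_op \<alpha> T KU KR) x'"
  shows "op_norm (P_op \<alpha> T KU KR) x \<le> 2 * (3 + 2 * (2 + (norm T * M)\<^sup>2 + 3 * \<beta>)) * \<delta>"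
proof -
  let ?N = "op_norm (P_op \<alpha> T KU KR)"
  obtain u p y r where x: "x = (u, p, y, r)" by (metis surj_pair)
  define \<Lambda> where "\<Lambda> = 2 + (norm T * M)\<^sup>2 + 3 * \<beta>"
  define N where "N = ?N x"
  define e where "e = norm (sqrt \<alpha> *\<^sub>R u, T y)"
  define m2 where "m2 = (norm p)\<^sup>2 / \<alpha> + (norm r)\<^sup>2"
  have N0: "0 \<le> ?N x'" for x' by (simp add: op_norm_eq_norm_energy_map[OF \<alpha>])
  have e2: "e\<^sup>2 = \<alpha> * (norm u)\<^sup>2 + (norm (T y))\<^sup>2"
    unfolding e_def using \<alpha> by (simp add: norm_Pair power_mult_distrib)
  have m20: "0 \<le> m2" unfolding m2_def using \<alpha> by simp
  have \<Lambda>: "2 \<le> \<Lambda>" unfolding \<Lambda>_def using \<beta> by simp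

  have tri: "(norm (a - b))\<^sup>2 \<le> 2 * (norm a)\<^sup>2 + 2 * (norm b)\<^sup>2" for a b :: 'u
    using norm_add_squared_le[of a "- b"] by simp

  \<comment> \<open>Test with the residuals of the two constraints, the first one scaled by \<open>\<alpha>\<close> to fit the norm.\<close>
  have constraint: "\<alpha> * (norm (u + riesz_inv (KU y)))\<^sup>2 + (norm (KR y))\<^sup>2 \<le> \<delta>\<^sup>2"
  proof -
    define w where "w = u + riesz_inv (KU y)"
    define \<rho> where "\<rho> = ?N (0, \<alpha> *\<^sub>R w, 0, riesz_inv (KR y))"
    have \<rho>2: "\<rho>\<^sup>2 = \<alpha> * (norm w)\<^sup>2 + (norm (KR y))\<^sup>2"
      unfolding \<rho>_def op_norm_P_op_squared[OF \<alpha>]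
      using \<alpha> by (simp add: power_mult_distrib power2_eq_square)
    have KRn: "KR y (riesz_inv (KR y)) = (norm (KR y))\<^sup>2"
      using power2_norm_eq_inner[of "riesz_inv (KR y)"] by simp
    have "w \<bullet> w = u \<bullet> w + KU y w" unfolding w_def by (simp add: inner_add_left)
    then have "A_op \<alpha> T KU KR x (0, \<alpha> *\<^sub>R w, 0, riesz_inv (KR y)) = \<rho>\<^sup>2"
      unfolding x A_op_apply \<rho>2 by (simp add: blinfun.scaleR_right KRn power2_norm_eq_inner flip: distrib_left)
    with res have "\<rho> * \<rho> \<le> \<delta> * \<rho>" unfolding \<rho>_def by (metis power2_eq_square)
    then have "\<rho> \<le> \<delta>" using \<delta> by (cases "\<rho> = 0") (auto simp: \<rho>_def N0 less_le)
    then have "\<rho>\<^sup>2 \<le> \<delta>\<^sup>2" by (rule power_mono) (simp add: \<rho>_def N0)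
    then show ?thesis unfolding \<rho>2 w_def .
  qed

  \<comment> \<open>Test with \<open>(v, 0, z, 0)\<close>, where \<open>v\<close> and \<open>z\<close> make the multiplier terms add up to exactly \<open>m2\<close>.\<close>
  have multiplier: "m2 \<le> \<Lambda> * (\<delta> + e)\<^sup>2"
  proof -
    obtain z where z: "KR z = riesz r" "norm z \<le> M * norm r" "\<alpha> * (norm (KU z))\<^sup>2 \<le> \<beta> * (norm r)\<^sup>2"
      using lift by blast
    define v where "v = (1 / \<alpha>) *\<^sub>R p - riesz_inv (KU z)"
    define n where "n = ?N (v, 0, z, 0)"
    have n2: "n\<^sup>2 = \<alpha> * (norm v)\<^sup>2 + (norm (T z))\<^sup>2 + \<alpha> * (norm (KU z))\<^sup>2 + (norm r)\<^sup>2"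
      unfolding n_def op_norm_P_op_squared[OF \<alpha>] z(1) by simp
    have "\<alpha> * (norm v)\<^sup>2 \<le> \<alpha> * (2 * (norm ((1 / \<alpha>) *\<^sub>R p))\<^sup>2 + 2 * (norm (riesz_inv (KU z)))\<^sup>2)"
      unfolding v_def using \<alpha> by (intro mult_left_mono tri) simp
    also have "\<dots> = 2 * ((norm p)\<^sup>2 / \<alpha>) + 2 * (\<alpha> * (norm (KU z))\<^sup>2)"
      using \<alpha> by (simp add: power_divide algebra_simps power2_eq_square[of \<alpha>])
    finally have av: "\<alpha> * (norm v)\<^sup>2 \<le> 2 * ((norm p)\<^sup>2 / \<alpha>) + 2 * (\<alpha> * (norm (KU z))\<^sup>2)" .
    have Tz: "(norm (T z))\<^sup>2 \<le> (norm T * M)\<^sup>2 * (norm r)\<^sup>2"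
      using z(2) by (rule norm_apply_squared_le)
    have "n\<^sup>2 \<le> 2 * ((norm p)\<^sup>2 / \<alpha>) + (norm T * M)\<^sup>2 * (norm r)\<^sup>2 + 3 * (\<beta> * (norm r)\<^sup>2) + (norm r)\<^sup>2"
      unfolding n2 using av Tz z(3) by linarith
    also have "\<dots> \<le> 2 * ((norm p)\<^sup>2 / \<alpha>) + \<Lambda> * (norm r)\<^sup>2"
      unfolding \<Lambda>_def by (simp add: algebra_simps)
    also have "\<dots> \<le> \<Lambda> * ((norm p)\<^sup>2 / \<alpha>) + \<Lambda> * (norm r)\<^sup>2"
      using \<Lambda> \<alpha> by (intro add_right_mono mult_right_mono) auto
    also have "\<dots> = \<Lambda> * m2" by (simp add: m2_def distrib_left)
    finally have nm: "n\<^sup>2 \<le> \<Lambda> * m2" .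
    have pv: "p \<bullet> v + KU z p = (norm p)\<^sup>2 / \<alpha>"
      unfolding v_def inner_diff_right
      by (simp add: inner_commute[of p "riesz_inv _"] power2_norm_eq_inner)
    have "A_op \<alpha> T KU KR x (v, 0, z, 0) = \<alpha> * (u \<bullet> v) + T y \<bullet> T z + m2"
      unfolding x A_op_apply using pv z(1) by (simp add: m2_def power2_norm_eq_inner)
    with res[of "(v, 0, z, 0)"] have "m2 \<le> \<delta> * n - (\<alpha> * (u \<bullet> v) + T y \<bullet> T z)"
      unfolding n_def by linarith
    moreover have "- (\<alpha> * (u \<bullet> v) + T y \<bullet> T z) \<le> e * n"
    proof -
      have "(norm (sqrt \<alpha> *\<^sub>R v, T z))\<^sup>2 \<le> n\<^sup>2"
        unfolding n2 using \<alpha> by (simp add: norm_Pair power_mult_distrib)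
      then have le: "norm (sqrt \<alpha> *\<^sub>R v, T z) \<le> n"
        by (rule power2_le_imp_le) (simp add: n_def N0)
      have "\<alpha> * (u \<bullet> v) + T y \<bullet> T z = (sqrt \<alpha> *\<^sub>R u, T y) \<bullet> (sqrt \<alpha> *\<^sub>R v, T z)"
        using \<alpha> by (simp flip: mult.assoc)
      also have "- \<dots> \<le> e * norm (sqrt \<alpha> *\<^sub>R v, T z)"
        unfolding e_def using Cauchy_Schwarz_ineq2 by (metis abs_le_D2)
      also have "\<dots> \<le> e * n" using le by (intro mult_left_mono) (simp_all add: e_def)
      finally show ?thesis .
    qed
    ultimately have "m2 \<le> (\<delta> + e) * n" by (simp add: distrib_right)
    then have "m2\<^sup>2 \<le> ((\<delta> + e) * n)\<^sup>2" using m20 by (rule power_mono)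
    also have "\<dots> = (\<delta> + e)\<^sup>2 * n\<^sup>2" by (rule power_mult_distrib)
    also have "\<dots> \<le> (\<delta> + e)\<^sup>2 * (\<Lambda> * m2)" using nm by (rule mult_left_mono) simp
    finally have "m2 * m2 \<le> (\<Lambda> * (\<delta> + e)\<^sup>2) * m2" by (simp add: power2_eq_square mult_ac)
    then show ?thesis using m20 \<Lambda> by (cases "m2 = 0") auto
  qed

  \<comment> \<open>Changing the signs of the multipliers cancels all coupling terms.\<close>
  have energy: "e\<^sup>2 \<le> \<delta> * N"
  proof -
    have "?N (u, - p, y, - r) = N"
      unfolding N_def x op_norm_eq_norm_energy_map[OF \<alpha>] energy_map_def by (simp add: norm_Pair)
    moreover have "A_op \<alpha> T KU KR x (u, - p, y, - r) = e\<^sup>2"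
      unfolding x A_op_apply e2
      by (simp add: blinfun.minus_right power2_norm_eq_inner inner_commute)
    ultimately show ?thesis using res by metis
  qed

  have "\<alpha> * (norm (KU y))\<^sup>2 \<le> 2 * (\<alpha> * (norm (u + riesz_inv (KU y)))\<^sup>2) + 2 * (\<alpha> * (norm u)\<^sup>2)"
    using mult_left_mono[OF tri[of "u + riesz_inv (KU y)" u], of \<alpha>] \<alpha> by (simp add: algebra_simps)
  moreover have arith: "a + b + t + k + c + d \<le> 3 * (a + t) + 3 * f + (b + d)"
    if "k \<le> 2 * w + 2 * a" "w + c \<le> f" "0 \<le> t" "0 \<le> c" "0 \<le> f" for a b t k c d f w :: real
    using that by argo
  ultimately have "N\<^sup>2 \<le> 3 * e\<^sup>2 + 3 * \<delta>\<^sup>2 + m2"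
    unfolding N_def x op_norm_P_op_squared[OF \<alpha>] e2 m2_def
    by (intro arith[OF _ constraint] zero_le_power2)
  also have "m2 \<le> \<Lambda> * (2 * \<delta>\<^sup>2 + 2 * e\<^sup>2)"
  proof -
    have "(\<delta> + e)\<^sup>2 \<le> 2 * \<delta>\<^sup>2 + 2 * e\<^sup>2"
      using sum_squares_bound[of \<delta> e] by (simp add: power2_sum)
    then have "\<Lambda> * (\<delta> + e)\<^sup>2 \<le> \<Lambda> * (2 * \<delta>\<^sup>2 + 2 * e\<^sup>2)" using \<Lambda> by (intro mult_left_mono) auto
    with multiplier show ?thesis by linarith
  qed
  also have "3 * e\<^sup>2 + 3 * \<delta>\<^sup>2 + \<Lambda> * (2 * \<delta>\<^sup>2 + 2 * e\<^sup>2) = (3 + 2 * \<Lambda>) * (e\<^sup>2 + \<delta>\<^sup>2)"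
    by (simp add: algebra_simps)
  also have "\<dots> \<le> (3 + 2 * \<Lambda>) * (\<delta> * N + \<delta>\<^sup>2)"
    using energy \<Lambda> by (intro mult_left_mono) auto
  finally have quad: "N\<^sup>2 \<le> (3 + 2 * \<Lambda>) * (\<delta> * N + \<delta>\<^sup>2)" by simp
  \<comment> \<open>If \<open>N > 2 D \<delta>\<close> with \<open>D \<ge> 1\<close>, the right-hand side of the quadratic inequality is at most
    \<open>N\<^sup>2 / 2 + N\<^sup>2 / 4\<close>.\<close>
  have "N \<le> 2 * (3 + 2 * \<Lambda>) * \<delta>"
  proof (rule ccontr)
    define D where "D = 3 + 2 * \<Lambda>"
    assume "\<not> ?thesis"
    then have big: "2 * D * \<delta> < N" by (simp add: D_def)
    have D: "1 \<le> D" using \<Lambda> by (simp add: D_def)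
    have "\<delta> \<le> D * \<delta>" using D \<delta> by (simp add: mult_le_cancel_right1)
    then have \<delta>N: "\<delta> \<le> N / 2" using big by linarith
    have N: "0 < N" using big D \<delta> mult_nonneg_nonneg[of D \<delta>] by linarith
    have "2 * (D * \<delta>) * (N + \<delta>) < N * (N + \<delta>)"
      using big N \<delta> by (intro mult_strict_right_mono) auto
    then have "2 * (D * (\<delta> * N + \<delta>\<^sup>2)) < N * (N + \<delta>)" by (simp add: algebra_simps power2_eq_square)
    moreover have "N * (N + \<delta>) \<le> N * (N + N / 2)" using \<delta>N N by (intro mult_left_mono) auto
    ultimately have "2 * N\<^sup>2 < N * (N + N / 2)" using quad unfolding D_def by linarith
    then show False using N by (simp add: power2_eq_square algebra_simps)
  qed
  then show ?thesis unfolding N_def \<Lambda>_def .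
qed

text \<open>With \<open>w = \<P>\<inverse> \<A> x\<close>, Cauchy-Schwarz for \<open>\<P>\<close> makes the energy norm of \<open>w\<close> a residual bound \<open>\<delta>\<close>, and testing
  \<open>\<A> x\<close> with \<open>w\<close> itself gives the upper bound.\<close>
lemma preconditioned_two_sided_bound:
  fixes T :: "'y::{real_inner,complete_space} \<Rightarrow>\<^sub>L 'o::{real_inner,complete_space}"
    and KU :: "'y \<Rightarrow>\<^sub>L ('u::{real_inner,complete_space}) dual"
    and KR :: "'y \<Rightarrow>\<^sub>L ('r::{real_inner,complete_space}) dual"
  assumes \<alpha>: "0 < \<alpha>" and \<beta>: "0 \<le> \<beta>" and iso: "isomorphism (P_op \<alpha> T KU KR)"
    and lift: "\<And>r. \<exists>z. KR z = riesz r \<and> norm z \<le> M * norm r \<and> \<alpha> * (norm (KU z))\<^sup>2 \<le> \<beta> * (norm r)\<^sup>2"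
  shows "two_sided_bound (P_op \<alpha> T KU KR) (A_op \<alpha> T KU KR)
    (1 / (2 * (3 + 2 * (2 + (norm T * M)\<^sup>2 + 3 * \<beta>)))) 2"
proof -
  let ?P = "P_op \<alpha> T KU KR" and ?A = "A_op \<alpha> T KU KR"
  define D where "D = 2 * (3 + 2 * (2 + (norm T * M)\<^sup>2 + 3 * \<beta>))"
  have D: "0 < D" unfolding D_def using \<beta> by (simp add: add_pos_nonneg)
  have "1 / D * op_norm ?P x \<le> op_norm ?P (inv (blinfun_apply ?P) (?A x)) \<and>
        op_norm ?P (inv (blinfun_apply ?P) (?A x)) \<le> 2 * op_norm ?P x" for x
  proof -
    define w where "w = inv (blinfun_apply ?P) (?A x)"
    have w: "?P w = ?A x"
      using iso unfolding w_def isomorphism_def by (simp add: bij_is_surj surj_f_inv_f)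
    have N0: "0 \<le> op_norm ?P w" by (simp add: op_norm_eq_norm_energy_map[OF \<alpha>])
    have "op_norm ?P x \<le> D * op_norm ?P w"
      unfolding D_def
    proof (rule op_norm_le_residual[OF \<alpha> \<beta> N0 lift])
      show "?A x x' \<le> op_norm ?P w * op_norm ?P x'" for x'
        using P_op_Cauchy_Schwarz[OF \<alpha>, of T KU KR w x'] w by simp
    qed
    moreover have "op_norm ?P w \<le> 2 * op_norm ?P x"
    proof -
      have "op_norm ?P w * op_norm ?P w = ?P w w"
        unfolding op_norm_eq_norm_energy_map[OF \<alpha>] P_op_eq_inner_energy_map[OF \<alpha>]
        by (simp add: dot_square_norm power2_eq_square)
      also have "\<dots> \<le> 2 * op_norm ?P x * op_norm ?P w"
        unfolding w by (rule A_op_le_op_norm[OF \<alpha>])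
      finally show ?thesis
        using N0 by (cases "op_norm ?P w = 0") (auto simp: op_norm_eq_norm_energy_map[OF \<alpha>])
    qed
    ultimately show ?thesis unfolding w_def using D by (simp add: divide_simps mult.commute)
  qed
  then show ?thesis unfolding two_sided_bound_def D_def by blast
qed

section \<open>The isomorphism properties\<close>

lemma self_adjoint_P_op: "0 < \<alpha> \<Longrightarrow> self_adjoint (P_op \<alpha> T KU KR)"
  by (simp add: self_adjoint_def P_op_eq_inner_energy_map inner_commute)

lemma self_adjoint_A_op: "self_adjoint (A_op \<alpha> T KU KR)"
  by (auto simp: self_adjoint_def A_op_apply inner_commute)

context
  fixes T :: "'y::{real_inner,complete_space} \<Rightarrow>\<^sub>L 'o::{real_inner,complete_space}"
    and KU :: "'y \<Rightarrow>\<^sub>L ('u::{real_inner,complete_space}) dual"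
    and KR :: "'y \<Rightarrow>\<^sub>L ('r::{real_inner,complete_space}) dual"
    and \<alpha> cK :: real
  assumes \<alpha>: "0 < \<alpha>" and K1: "\<And>y. norm y \<le> cK * norm (K_op KU KR y)"
begin

lemma isomorphism_P_op: "isomorphism (P_op \<alpha> T KU KR)"
proof -
  obtain g where g: "0 < g" "\<And>x. g * norm x \<le> op_norm (P_op \<alpha> T KU KR) x"
    using op_norm_coercive[OF \<alpha> K1, where T = T] by blast
  have "g\<^sup>2 * norm x \<le> norm (P_op \<alpha> T KU KR x)" for x
  proof (cases "x = 0")
    case False
    have "(g * norm x)\<^sup>2 \<le> (op_norm (P_op \<alpha> T KU KR) x)\<^sup>2"
      using g by (intro power_mono) auto
    also have "\<dots> = P_op \<alpha> T KU KR x x"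
      unfolding op_norm_eq_norm_energy_map[OF \<alpha>] P_op_eq_inner_energy_map[OF \<alpha>]
      by (simp add: dot_square_norm)
    also have "\<dots> \<le> norm (P_op \<alpha> T KU KR x) * norm x"
      using norm_blinfun[of "P_op \<alpha> T KU KR x" x] by simp
    finally have "(g\<^sup>2 * norm x) * norm x \<le> norm (P_op \<alpha> T KU KR x) * norm x"
      by (simp add: power2_eq_square mult_ac)
    then show ?thesis using False by simp
  qed simp
  then show ?thesis
    using g(1) by (intro isomorphism_of_self_adjoint_bounded_below[OF self_adjoint_P_op[OF \<alpha>], of "g\<^sup>2"]) simp_all
qed

text \<open>Completeness: coercivity turns Cauchy sequences for the energy norm into Cauchy sequences for
  the canonical norm, and \<open>\<P>\<close> is continuous, so the limit is also a limit in the energy norm.\<close>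
lemma hilbert_inner_product_P_op: "hilbert_inner_product (P_op \<alpha> T KU KR)"
proof -
  let ?P = "P_op \<alpha> T KU KR"
  obtain g where g: "0 < g" "\<And>x. g * norm x \<le> op_norm ?P x"
    using op_norm_coercive[OF \<alpha> K1, where T = T] by blast
  have F0: "op_norm ?P x = 0 \<longleftrightarrow> x = 0" for x
  proof
    assume "op_norm ?P x = 0"
    with g(2)[of x] g(1) show "x = 0" by (simp add: mult_le_0_iff)
  qed (simp add: op_norm_def)
  have d: "op_norm ?P (x - y) = dist (energy_map \<alpha> T KU KR x) (energy_map \<alpha> T KU KR y)" for x y
    by (simp add: op_norm_eq_norm_energy_map[OF \<alpha>] energy_map_diff dist_norm)
  interpret E: Metric_space UNIV "\<lambda>x y. op_norm ?P (x - y)"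
  proof
    show "0 \<le> op_norm ?P (x - y)" "op_norm ?P (x - y) = op_norm ?P (y - x)"
      "op_norm ?P (x - z) \<le> op_norm ?P (x - y) + op_norm ?P (y - z)" for x y z
      unfolding d by (auto simp: dist_commute dist_triangle)
    show "op_norm ?P (x - y) = 0 \<longleftrightarrow> x = y" for x y
      using F0[of "x - y"] by simp
  qed
  have "E.mcomplete"
    unfolding E.mcomplete_def
  proof (intro allI impI)
    fix \<sigma> assume C: "E.MCauchy \<sigma>"
    have "Cauchy \<sigma>"
    proof (rule metric_CauchyI)
      fix e :: real assume "0 < e"
      then have "0 < g * e" using g by simp
      then obtain N where N: "\<And>m n. N \<le> m \<Longrightarrow> N \<le> n \<Longrightarrow> op_norm ?P (\<sigma> m - \<sigma> n) < g * e"
        using C unfolding E.MCauchy_def by blast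
      have "dist (\<sigma> m) (\<sigma> n) < e" if "N \<le> m" "N \<le> n" for m n
      proof -
        have "g * norm (\<sigma> m - \<sigma> n) < g * e" using g(2) N[OF that] by (rule le_less_trans)
        then show ?thesis using g(1) by (simp add: dist_norm)
      qed
      then show "\<exists>M. \<forall>m\<ge>M. \<forall>n\<ge>M. dist (\<sigma> m) (\<sigma> n) < e" by blast
    qed
    then obtain l where l: "\<sigma> \<longlonglongrightarrow> l" using Cauchy_convergent convergent_def by blast
    have "(\<lambda>n. op_norm ?P (\<sigma> n - l)) \<longlonglongrightarrow> op_norm ?P (l - l)"
      unfolding op_norm_def by (intro tendsto_intros l)
    moreover have "op_norm ?P (l - l) = 0" by (simp add: op_norm_def)
    ultimately have lim: "(\<lambda>n. op_norm ?P (\<sigma> n - l)) \<longlonglongrightarrow> 0" by metis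
    have "limitin E.mtopology \<sigma> l sequentially"
      unfolding E.limit_metric_sequentially
    proof (intro conjI allI impI)
      fix e :: real assume "0 < e"
      then show "\<exists>N. \<forall>n\<ge>N. \<sigma> n \<in> UNIV \<and> op_norm ?P (\<sigma> n - l) < e"
        using order_tendstoD(2)[OF lim] by (simp add: eventually_sequentially)
    qed simp
    then show "\<exists>l. limitin E.mtopology \<sigma> l sequentially" by blast
  qed
  moreover have "0 < ?P x x" if "x \<noteq> 0" for x
    using that F0[of x] unfolding op_norm_eq_norm_energy_map[OF \<alpha>] P_op_eq_inner_energy_map[OF \<alpha>]
    by simp
  moreover have "?P x y = ?P y x" for x y
    unfolding P_op_eq_inner_energy_map[OF \<alpha>] by (rule inner_commute)
  ultimately show ?thesis
    unfolding hilbert_inner_product_def by (intro conjI allI impI)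
qed

text \<open>For a single \<open>\<alpha>\<close> the lifting energy bound \<open>\<beta> = \<alpha> (\<parallel>K\<^sub>U\<parallel> M)\<^sup>2\<close> is available, and coercivity
  converts the a priori estimate from the energy norm to the canonical norm.\<close>
lemma isomorphism_A_op:
  assumes lift: "\<And>r. \<exists>z. KR z = riesz r \<and> norm z \<le> M * norm r"
  shows "isomorphism (A_op \<alpha> T KU KR)"
proof -
  let ?P = "P_op \<alpha> T KU KR" and ?A = "A_op \<alpha> T KU KR"
  obtain g where g: "0 < g" "\<And>x. g * norm x \<le> op_norm ?P x"
    using op_norm_coercive[OF \<alpha> K1, where T = T] by blast
  define \<beta> where "\<beta> = \<alpha> * (norm KU * M)\<^sup>2"
  have \<beta>: "0 \<le> \<beta>" unfolding \<beta>_def using \<alpha> by simp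
  define D where "D = 2 * (3 + 2 * (2 + (norm T * M)\<^sup>2 + 3 * \<beta>))"
  have D: "0 < D" unfolding D_def using \<beta> by (simp add: add_pos_nonneg)
  have lift': "\<exists>z. KR z = riesz r \<and> norm z \<le> M * norm r \<and> \<alpha> * (norm (KU z))\<^sup>2 \<le> \<beta> * (norm r)\<^sup>2" for r
  proof -
    obtain z where z: "KR z = riesz r" "norm z \<le> M * norm r" using lift by blast
    have "\<alpha> * (norm (KU z))\<^sup>2 \<le> \<alpha> * ((norm KU * M)\<^sup>2 * (norm r)\<^sup>2)"
      using \<alpha> by (intro mult_left_mono norm_apply_squared_le[OF z(2)]) simp
    then show ?thesis using z unfolding \<beta>_def mult.assoc by blast
  qed
  have "(g * g / D) * norm x \<le> norm (?A x)" for x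
  proof -
    define \<delta> where "\<delta> = norm (?A x) / g"
    have "op_norm ?P x \<le> D * \<delta>"
      unfolding D_def
    proof (rule op_norm_le_residual[OF \<alpha> \<beta> _ lift'])
      show "0 \<le> \<delta>" using g by (simp add: \<delta>_def)
      show "?A x x' \<le> \<delta> * op_norm ?P x'" for x'
      proof -
        have "?A x x' \<le> norm (?A x) * norm x'" using norm_blinfun[of "?A x" x'] by simp
        also have "\<dots> = \<delta> * (g * norm x')" using g by (simp add: \<delta>_def)
        also have "\<dots> \<le> \<delta> * op_norm ?P x'"
          using g by (intro mult_left_mono g(2)) (simp add: \<delta>_def)
        finally show ?thesis .
      qed
    qed
    with g(2)[of x] have "g * norm x \<le> D * \<delta>" by linarith
    then show ?thesis using g(1) D by (simp add: \<delta>_def field_simps)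
  qed
  then show ?thesis
    using g(1) D by (intro isomorphism_of_self_adjoint_bounded_below[OF self_adjoint_A_op, of "g * g / D"]) simp_all
qed

end

theorem theorem3p5:
  fixes T :: "'y::{real_inner,complete_space} \<Rightarrow>\<^sub>L 'o::{real_inner,complete_space}"
    and KU :: "'y \<Rightarrow>\<^sub>L ('u::{real_inner,complete_space}) dual"
    and KR :: "'y \<Rightarrow>\<^sub>L ('r::{real_inner,complete_space}) dual"
  shows
    "(surj (blinfun_apply KR) \<longleftrightarrow> (\<exists>cR>0. inf_sup_on UNIV KR cR)) \<and>
     (blinfun_apply KR ` ker KU = UNIV \<longleftrightarrow> (\<exists>cR>0. inf_sup_on (ker KU) KR cR)) \<and>
     ((\<exists>cK>0. \<forall>y. norm y \<le> cK * norm (K_op KU KR y)) \<longrightarrow>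
       (surj (blinfun_apply KR) \<longrightarrow>
         (\<forall>\<alpha>>0. self_adjoint (A_op \<alpha> T KU KR) \<and> isomorphism (A_op \<alpha> T KU KR) \<and>
                 isomorphism (P_op \<alpha> T KU KR) \<and> hilbert_inner_product (P_op \<alpha> T KU KR)) \<and>
         (\<exists>c>0. \<exists>C>0. \<forall>\<alpha>. 0 < \<alpha> \<and> \<alpha> \<le> 1 \<longrightarrow>
           two_sided_bound (P_op \<alpha> T KU KR) (A_op \<alpha> T KU KR) c C)) \<and>
       (blinfun_apply KR ` ker KU = UNIV \<longrightarrow>
         (\<exists>c>0. \<exists>C>0. \<forall>\<alpha>>0.
           two_sided_bound (P_op \<alpha> T KU KR) (A_op \<alpha> T KU KR) c C)))"
proof (intro conjI impI)
  show "surj (blinfun_apply KR) \<longleftrightarrow> (\<exists>cR>0. inf_sup_on UNIV KR cR)"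
    by (rule surjective_on_iff_inf_sup_on) simp_all
  show "blinfun_apply KR ` ker KU = UNIV \<longleftrightarrow> (\<exists>cR>0. inf_sup_on (ker KU) KR cR)"
    by (rule surjective_on_iff_inf_sup_on[OF subspace_ker closed_ker])
next
  assume "\<exists>cK>0. \<forall>y. norm y \<le> cK * norm (K_op KU KR y)" and onto: "surj (blinfun_apply KR)"
  then obtain cK where K1: "\<And>y. norm y \<le> cK * norm (K_op KU KR y)" by blast
  obtain M where "\<And>f. \<exists>z\<in>UNIV. KR z = f \<and> norm z \<le> M * norm f"
    using surjective_on_imp_bounded_right_inverse[OF subspace_UNIV closed_UNIV onto] by blast
  then have lift: "\<exists>z. KR z = riesz r \<and> norm z \<le> M * norm r" for r
    by (metis norm_riesz_apply)
  show "\<forall>\<alpha>>0. self_adjoint (A_op \<alpha> T KU KR) \<and> isomorphism (A_op \<alpha> T KU KR) \<and>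
      isomorphism (P_op \<alpha> T KU KR) \<and> hilbert_inner_product (P_op \<alpha> T KU KR)"
    by (intro allI impI conjI self_adjoint_A_op isomorphism_A_op[OF _ K1 lift]
        isomorphism_P_op[OF _ K1] hilbert_inner_product_P_op[OF _ K1])
  \<comment> \<open>For \<open>\<alpha> \<le> 1\<close> the energy of the lifting has a bound without \<open>\<alpha>\<close>.\<close>
  have lift': "\<exists>z. KR z = riesz r \<and> norm z \<le> M * norm r \<and>
      \<alpha> * (norm (KU z))\<^sup>2 \<le> (norm KU * M)\<^sup>2 * (norm r)\<^sup>2" if "0 < \<alpha>" "\<alpha> \<le> 1" for \<alpha> r
  proof -
    obtain z where z: "KR z = riesz r" "norm z \<le> M * norm r" using lift by blast
    have "\<alpha> * (norm (KU z))\<^sup>2 \<le> (norm (KU z))\<^sup>2" using that by (intro mult_left_le_one_le) auto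
    also have "\<dots> \<le> (norm KU * M)\<^sup>2 * (norm r)\<^sup>2" using z(2) by (rule norm_apply_squared_le)
    finally show ?thesis using z by blast
  qed
  show "\<exists>c>0. \<exists>C>0. \<forall>\<alpha>. 0 < \<alpha> \<and> \<alpha> \<le> 1 \<longrightarrow>
      two_sided_bound (P_op \<alpha> T KU KR) (A_op \<alpha> T KU KR) c C"
  proof (rule exI[of _ "1 / (2 * (3 + 2 * (2 + (norm T * M)\<^sup>2 + 3 * (norm KU * M)\<^sup>2)))"], intro conjI exI[of _ 2] allI impI)
    show "0 < 1 / (2 * (3 + 2 * (2 + (norm T * M)\<^sup>2 + 3 * (norm KU * M)\<^sup>2)))" by (simp add: add_pos_nonneg)
  qed (use preconditioned_two_sided_bound[where T = T and M = M, OF _ _ isomorphism_P_op[OF _ K1] lift'] in auto)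
next
  assume "\<exists>cK>0. \<forall>y. norm y \<le> cK * norm (K_op KU KR y)" and onto: "blinfun_apply KR ` ker KU = UNIV"
  then obtain cK where K1: "\<And>y. norm y \<le> cK * norm (K_op KU KR y)" by blast
  obtain M where "\<And>f. \<exists>z\<in>ker KU. KR z = f \<and> norm z \<le> M * norm f"
    using surjective_on_imp_bounded_right_inverse[OF subspace_ker closed_ker onto] by blast
  then have lift: "\<exists>z\<in>ker KU. KR z = riesz r \<and> norm z \<le> M * norm r" for r
    by (metis norm_riesz_apply)
  \<comment> \<open>A lifting in the kernel of \<open>KU\<close> has no \<open>\<alpha>\<close>-dependent energy at all.\<close>
  have lift': "\<exists>z. KR z = riesz r \<and> norm z \<le> M * norm r \<and>
      \<alpha> * (norm (KU z))\<^sup>2 \<le> 0 * (norm r)\<^sup>2" for \<alpha> r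
    using lift[of r] by (auto simp: ker_def)
  show "\<exists>c>0. \<exists>C>0. \<forall>\<alpha>>0. two_sided_bound (P_op \<alpha> T KU KR) (A_op \<alpha> T KU KR) c C"
  proof (rule exI[of _ "1 / (2 * (3 + 2 * (2 + (norm T * M)\<^sup>2 + 3 * 0)))"], intro conjI exI[of _ 2] allI impI)
    show "0 < 1 / (2 * (3 + 2 * (2 + (norm T * M)\<^sup>2 + 3 * 0)))" by (simp add: add_pos_nonneg)
  qed (use preconditioned_two_sided_bound[where T = T and M = M, OF _ _ isomorphism_P_op[OF _ K1] lift'] in auto)
qed

end
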